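(* Let $x\in\{u,l,f\}$. (Positive part.) For any two graph classes $\mathcal{G},\mathcal{H}$, the class $\mathcal{H}$ is $(\operatorname{ic}_x^{\mathcal{G}},\operatorname{c}_x^{\mathcal{G}})$-bounded provided one of the following holds: 1. $\mathcal{G}$ is hereditary and has bounded maximum average degree. 2. $\mathcal{G}$ is hereditary and $\mathcal{H}$ has bounded maximum average degree. (Negative part.) In each of the following two cases there exist graph classes $\mathcal{G},\mathcal{H}$ with the listed properties such that $\mathcal{H}$ is not $(\operatorname{ic}_x^{\mathcal{G}},\operatorname{c}_x^{\mathcal{G}})$-bounded: 1. $\mathcal{G}$ is hereditary. 2. $\mathcal{G}$ is component-closed and $\mathcal{H}$ has bounded treewidth.
   Context: Graphs are finite and simple; graph classes are closed under isomorphism. A $\mathcal{G}$-cover of a graph $H$ is a graph homomorphism $\varphi\colon G_1\sqcup\dots\sqcup G_t\to H$ (disjoint union) with $G_i\in\mathcal{G}$ for all $i$, such that every edge of $H$ is the image of some edge. It is injective if each $G_i$ is isomorphic via $\varphi$ to its image $\varphi(G_i)\subseteq H$. A subgraph $H'$ of $H$ is weak induced if each connected component of $H'$ is an induced subgraph of $H$; a cover is weak induced if each image $\varphi(G_i)$ is a weak induced subgraph of $H$. $\overline{\mathcal{G}}$ denotes the class of all vertex-disjoint unions of graphs in $\mathcal{G}$. Covering numbers of $H$: - union: $\operatorname{c}_u^{\mathcal{G}}(H)$ is the smallest $t$ such that $H$ has an injective $\overline{\mathcal{G}}$-cover with $t$ guests; - local: $\operatorname{c}_l^{\mathcal{G}}(H)$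 is the smallest $\ell$ such that $H$ has an injective $\mathcal{G}$-cover $\varphi$ (any number of guests) with $|\varphi^{-1}(v)|\le\ell$ for all $v\in V(H)$; - folded: $\operatorname{c}_f^{\mathcal{G}}(H)$ is the smallest $\ell$ such that $H$ has a (not necessarily injective) $\mathcal{G}$-cover $\varphi$ with $|\varphi^{-1}(v)|\le\ell$ for all $v\in V(H)$. The induced variants $\operatorname{ic}_u^{\mathcal{G}}(H),\operatorname{ic}_l^{\mathcal{G}}(H),\operatorname{ic}_f^{\mathcal{G}}(H)$ are defined in the same way with the cover additionally required to be weak induced. Each number is $\infty$ if no such cover exists. A graph class $\mathcal{H}$ is $(\operatorname{ic}_x^{\mathcal{G}},\operatorname{c}_x^{\mathcal{G}})$-bounded if there is a function $f\colon\mathbb{N}\to\mathbb{N}$ with $\operatorname{ic}_x^{\mathcal{G}}(H)\le f(\operatorname{c}_x^{\mathcal{G}}(H))$ for every $H\in\mathcal{H}$ (the inequality being required only when $\operatorname{c}_x^{\mathcal{G}}(H)<\infty$). A class is component-closed if it contains every connected component of each of its members, hereditary if closed under induced subgraphs. The maximum average degree of $G$ is $\operatorname{mad}(G)=\max\{2|E(G')|/|V(G')| : G'\subseteq G,\ |V(G')|\ge 1\}$. A parameter $p$ is bounded on a class $\mathcal{Q}$ if $\sup_{G\in\mathcal{Q}}p(G)<\infty$. *)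

theory Defs
  imports Complex_Main "HOL-Library.Extended_Nat"
begin

section \<open>Finite simple graphs\<close>

datatype 'a graph = Graph (verts: "'a set") (edges: "'a set set")

definition fin_graph :: "'a graph \<Rightarrow> bool" where
  "fin_graph G \<longleftrightarrow> finite (verts G) \<and> (\<forall>e\<in>edges G. e \<subseteq> verts G \<and> card e = 2)"

definition subgraph :: "'a graph \<Rightarrow> 'a graph \<Rightarrow> bool" where
  "subgraph K G \<longleftrightarrow> fin_graph K \<and> fin_graph G \<and> verts K \<subseteq> verts G \<and> edges K \<subseteq> edges G"

definition induced_subgraph :: "'a graph \<Rightarrow> 'a graph \<Rightarrow> bool" where
  "induced_subgraph K G \<longleftrightarrow> subgraph K G \<and> edges K = {e \<in> edges G. e \<subseteq> verts K}"

definition adj :: "'a graph \<Rightarrow> ('a \<times> 'a) set" where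
  "adj G = {(u, v). {u, v} \<in> edges G}"

text \<open>The graph without vertices is allowed, but it is not connected and has no components.\<close>

definition connected_graph :: "'a graph \<Rightarrow> bool" where
  "connected_graph G \<longleftrightarrow> verts G \<noteq> {} \<and> (\<forall>u\<in>verts G. \<forall>v\<in>verts G. (u, v) \<in> (adj G)\<^sup>*)"

definition component :: "'a graph \<Rightarrow> 'a graph \<Rightarrow> bool" where
  "component K G \<longleftrightarrow> subgraph K G \<and> connected_graph K \<and>
     (\<forall>K'. subgraph K' G \<and> connected_graph K' \<and> subgraph K K' \<longrightarrow> K' = K)"

definition weak_induced_subgraph :: "'a graph \<Rightarrow> 'a graph \<Rightarrow> bool" where
  "weak_induced_subgraph K H \<longleftrightarrow> subgraph K H \<and> (\<forall>C. component C K \<longrightarrow> induced_subgraph C H)"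

text \<open>As edges have two elements, \<open>f ` e \<in> edges H\<close> says in particular that the
  endpoints of \<open>e\<close> have different images.\<close>

definition graph_hom :: "('a \<Rightarrow> 'b) \<Rightarrow> 'a graph \<Rightarrow> 'b graph \<Rightarrow> bool" where
  "graph_hom f G H \<longleftrightarrow> f ` verts G \<subseteq> verts H \<and> (\<forall>e\<in>edges G. f ` e \<in> edges H)"

definition graph_iso :: "('a \<Rightarrow> 'b) \<Rightarrow> 'a graph \<Rightarrow> 'b graph \<Rightarrow> bool" where
  "graph_iso f G H \<longleftrightarrow> bij_betw f (verts G) (verts H) \<and>
     (\<forall>u\<in>verts G. \<forall>v\<in>verts G. {u, v} \<in> edges G \<longleftrightarrow> {f u, f v} \<in> edges H)"

definition isomorphic :: "'a graph \<Rightarrow> 'b graph \<Rightarrow> bool" where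
  "isomorphic G H \<longleftrightarrow> (\<exists>f. graph_iso f G H)"

definition graph_image :: "('a \<Rightarrow> 'b) \<Rightarrow> 'a graph \<Rightarrow> 'b graph" where
  "graph_image f G = Graph (f ` verts G) ((\<lambda>e. f ` e) ` edges G)"

text \<open>The vertex \<open>v\<close> of the \<open>i\<close>-th graph becomes the vertex \<open>(i, v)\<close>.\<close>

definition disjoint_union :: "'a graph list \<Rightarrow> (nat \<times> 'a) graph" where
  "disjoint_union Gs = Graph
     {(i, v) | i v. i < length Gs \<and> v \<in> verts (Gs ! i)}
     {Pair i ` e | i e. i < length Gs \<and> e \<in> edges (Gs ! i)}"


section \<open>Graph classes\<close>

text \<open>Every finite graph is isomorphic to one with vertices in \<open>nat\<close>, so a graph class is
  represented by its members on \<open>nat\<close>.\<close>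

definition graph_class :: "nat graph set \<Rightarrow> bool" where
  "graph_class \<C> \<longleftrightarrow> (\<forall>G\<in>\<C>. fin_graph G) \<and>
     (\<forall>G\<in>\<C>. \<forall>G'. fin_graph G' \<and> isomorphic G G' \<longrightarrow> G' \<in> \<C>)"

definition hereditary :: "nat graph set \<Rightarrow> bool" where
  "hereditary \<C> \<longleftrightarrow> (\<forall>G\<in>\<C>. \<forall>K. induced_subgraph K G \<longrightarrow> K \<in> \<C>)"

definition component_closed :: "nat graph set \<Rightarrow> bool" where
  "component_closed \<C> \<longleftrightarrow> (\<forall>G\<in>\<C>. \<forall>K. component K G \<longrightarrow> K \<in> \<C>)"

definition disjoint_unions :: "nat graph set \<Rightarrow> nat graph set" where
  "disjoint_unions \<C> =
     {U. fin_graph U \<and> (\<exists>Gs. set Gs \<subseteq> \<C> \<and> isomorphic (disjoint_union Gs) U)}"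


section \<open>Covers and covering numbers\<close>

definition cover ::
    "nat graph set \<Rightarrow> 'a graph \<Rightarrow> nat graph list \<Rightarrow> (nat \<times> nat \<Rightarrow> 'a) \<Rightarrow> bool" where
  "cover \<G> H Gs \<phi> \<longleftrightarrow> set Gs \<subseteq> \<G> \<and> graph_hom \<phi> (disjoint_union Gs) H \<and>
     (\<forall>e\<in>edges H. \<exists>e'\<in>edges (disjoint_union Gs). \<phi> ` e' = e)"

definition guest_map :: "(nat \<times> nat \<Rightarrow> 'a) \<Rightarrow> nat \<Rightarrow> nat \<Rightarrow> 'a" where
  "guest_map \<phi> i = (\<lambda>v. \<phi> (i, v))"

definition injective_cover :: "nat graph list \<Rightarrow> (nat \<times> nat \<Rightarrow> 'a) \<Rightarrow> bool" where
  "injective_cover Gs \<phi> \<longleftrightarrow>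
     (\<forall>i<length Gs. graph_iso (guest_map \<phi> i) (Gs ! i) (graph_image (guest_map \<phi> i) (Gs ! i)))"

definition weak_induced_cover ::
    "'a graph \<Rightarrow> nat graph list \<Rightarrow> (nat \<times> nat \<Rightarrow> 'a) \<Rightarrow> bool" where
  "weak_induced_cover H Gs \<phi> \<longleftrightarrow>
     (\<forall>i<length Gs. weak_induced_subgraph (graph_image (guest_map \<phi> i) (Gs ! i)) H)"

definition fibres_le ::
    "'a graph \<Rightarrow> nat graph list \<Rightarrow> (nat \<times> nat \<Rightarrow> 'a) \<Rightarrow> nat \<Rightarrow> bool" where
  "fibres_le H Gs \<phi> l \<longleftrightarrow>
     (\<forall>v\<in>verts H. card {w \<in> verts (disjoint_union Gs). \<phi> w = v} \<le> l)"

text \<open>In \<open>enat\<close> the infimum of a nonempty set is its least element, and \<open>Inf {} = \<infinity>\<close>.\<close>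

definition c_union :: "nat graph set \<Rightarrow> 'a graph \<Rightarrow> enat" where
  "c_union \<G> H = Inf {enat (length Gs) | Gs \<phi>.
     cover (disjoint_unions \<G>) H Gs \<phi> \<and> injective_cover Gs \<phi>}"

definition c_local :: "nat graph set \<Rightarrow> 'a graph \<Rightarrow> enat" where
  "c_local \<G> H = Inf {enat l | l Gs \<phi>.
     cover \<G> H Gs \<phi> \<and> injective_cover Gs \<phi> \<and> fibres_le H Gs \<phi> l}"

definition c_folded :: "nat graph set \<Rightarrow> 'a graph \<Rightarrow> enat" where
  "c_folded \<G> H = Inf {enat l | l Gs \<phi>.
     cover \<G> H Gs \<phi> \<and> fibres_le H Gs \<phi> l}"

definition ic_union :: "nat graph set \<Rightarrow> 'a graph \<Rightarrow> enat" where
  "ic_union \<G> H = Inf {enat (length Gs) | Gs \<phi>.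
     cover (disjoint_unions \<G>) H Gs \<phi> \<and> injective_cover Gs \<phi> \<and> weak_induced_cover H Gs \<phi>}"

definition ic_local :: "nat graph set \<Rightarrow> 'a graph \<Rightarrow> enat" where
  "ic_local \<G> H = Inf {enat l | l Gs \<phi>.
     cover \<G> H Gs \<phi> \<and> injective_cover Gs \<phi> \<and> weak_induced_cover H Gs \<phi> \<and> fibres_le H Gs \<phi> l}"

definition ic_folded :: "nat graph set \<Rightarrow> 'a graph \<Rightarrow> enat" where
  "ic_folded \<G> H = Inf {enat l | l Gs \<phi>.
     cover \<G> H Gs \<phi> \<and> weak_induced_cover H Gs \<phi> \<and> fibres_le H Gs \<phi> l}"

datatype variant = Union_Cover | Local_Cover | Folded_Cover

fun c_num :: "variant \<Rightarrow> nat graph set \<Rightarrow> 'a graph \<Rightarrow> enat" where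
  "c_num Union_Cover = c_union"
| "c_num Local_Cover = c_local"
| "c_num Folded_Cover = c_folded"

fun ic_num :: "variant \<Rightarrow> nat graph set \<Rightarrow> 'a graph \<Rightarrow> enat" where
  "ic_num Union_Cover = ic_union"
| "ic_num Local_Cover = ic_local"
| "ic_num Folded_Cover = ic_folded"

definition ic_c_bounded :: "variant \<Rightarrow> nat graph set \<Rightarrow> nat graph set \<Rightarrow> bool" where
  "ic_c_bounded x \<G> \<H> \<longleftrightarrow>
     (\<exists>f::nat \<Rightarrow> nat. \<forall>H\<in>\<H>. \<forall>k. c_num x \<G> H = enat k \<longrightarrow> ic_num x \<G> H \<le> enat (f k))"


section \<open>Maximum average degree and treewidth\<close>

text \<open>The graph without vertices gets the value 0.\<close>

definition mad :: "'a graph \<Rightarrow> real" where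
  "mad G = (if verts G = {} then 0 else
     Max {2 * real (card (edges K)) / real (card (verts K)) | K.
            subgraph K G \<and> card (verts K) \<ge> 1})"

definition is_cycle :: "'a graph \<Rightarrow> 'a list \<Rightarrow> bool" where
  "is_cycle G vs \<longleftrightarrow> length vs \<ge> 3 \<and> distinct vs \<and>
     (\<forall>i. Suc i < length vs \<longrightarrow> {vs ! i, vs ! Suc i} \<in> edges G) \<and> {last vs, hd vs} \<in> edges G"

definition is_tree :: "'a graph \<Rightarrow> bool" where
  "is_tree T \<longleftrightarrow> fin_graph T \<and> connected_graph T \<and> (\<nexists>vs. is_cycle T vs)"

definition tree_decomposition :: "'a graph \<Rightarrow> nat graph \<Rightarrow> (nat \<Rightarrow> 'a set) \<Rightarrow> bool" where
  "tree_decomposition G T B \<longleftrightarrow> is_tree T \<and>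
     (\<Union>t\<in>verts T. B t) = verts G \<and>
     (\<forall>e\<in>edges G. \<exists>t\<in>verts T. e \<subseteq> B t) \<and>
     (\<forall>v\<in>verts G. \<exists>S. induced_subgraph S T \<and> verts S = {t \<in> verts T. v \<in> B t} \<and>
        connected_graph S)"

text \<open>The subtraction truncates only for the graph without vertices.\<close>

definition decomposition_width :: "nat graph \<Rightarrow> (nat \<Rightarrow> 'a set) \<Rightarrow> nat" where
  "decomposition_width T B = Max ((\<lambda>t. card (B t)) ` verts T) - 1"

definition treewidth :: "'a graph \<Rightarrow> nat" where
  "treewidth G = (LEAST k. \<exists>T B. tree_decomposition G T B \<and> decomposition_width T B = k)"

end

theory Submission
  imports Defs
begin

text \<open>
  The three variants are handled together. Splitting the guests of an injective cover by disjoint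
  unions into the parts of these unions gives an injective cover by graphs of the class, in which
  a vertex lies in at most as many guests as there were unions. Hence the folded number is at most
  the local number, and the local number at most the union number, with and without the word
  induced (\<open>covering_numbers_between\<close>). For boundedness it therefore suffices to bound the
  induced union number in terms of the folded number. In a counterexample it suffices that the
  union number stays bounded while the induced folded number does not.

  Positive part. If the guests are sparse, then so is every host, up to a factor given by the
  folded number, because an edge inside a vertex set \<open>W\<close> comes from an edge inside the preimage
  of \<open>W\<close> (\<open>sparse_if_folded_cover\<close>). So both conditions lead to sparse hosts. These have a vertex
  ordering in which every vertex has few earlier neighbours, hence a proper colouring with few
  colours and an orientation with small outdegree, and their edges split into few star forests
  whose stars are induced in the host (\<open>ic_union_le_by_star_forests\<close>). If the hereditary class of
  guests contains all stars, this is the required cover. If it misses some star, then a guest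
  vertex has few neighbours that are mapped to one colour, since they are independent in the
  guest, so the host has bounded degree (\<open>degree_bound_without_star\<close>). In this case the star
  forests can be cut into few induced matchings, and a single edge is an induced subgraph of some
  guest.

  Negative part, hereditary guests. A complete graph on \<open>n\<close> vertices completely joined to \<open>n\<close>
  independent vertices is the union of a complete and a complete bipartite graph. A guest from
  these two families whose image is induced meets the bipartite part of the host only in stars.
  Each star can be charged to its leaves, and counting the \<open>n\<^sup>2\<close> edges of the bipartite part
  shows that some fibre has at least \<open>n / 2\<close> elements (\<open>ic_folded_complete_split\<close>).

  Negative part, bounded treewidth. The square of the cycle on seven vertices is covered by two
  rotated copies of the Moser spindle. The spindle is not 3-colourable, but the square of the cycle
  without any one vertex is, so every homomorphism from the spindle hits all seven vertices. Its
  image has at most 11 of the 14 edges and is not induced. So a weak induced cover by spindles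
  does not exist at all, although the host is a single graph.
\<close>

section \<open>Graphs, isomorphisms and weak induced subgraphs\<close>

lemma edge_verts:
  assumes "fin_graph G" "{u, v} \<in> edges G"
  shows "u \<in> verts G" "v \<in> verts G" "u \<noteq> v"
  using assms unfolding fin_graph_def by (auto simp: card_2_iff doubleton_eq_iff)

lemma edge_doubleton:
  assumes "fin_graph G" "e \<in> edges G"
  obtains u v where "e = {u, v}" "u \<noteq> v" "u \<in> verts G" "v \<in> verts G"
  using assms unfolding fin_graph_def by (metis card_2_iff insert_subset)

lemma edge_image_endpoints:
  assumes "fin_graph G" "e \<in> edges G" "f ` e = {a, b}"
  obtains u v where "e = {u, v}" "f u = a" "f v = b"
proof -
  obtain u v where "e = {u, v}" using assms(1,2) edge_doubleton by metis
  then show thesis using assms(3) that[of u v] that[of v u]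
    by (auto simp: doubleton_eq_iff insert_commute)
qed

lemma finite_edges: "fin_graph G \<Longrightarrow> finite (edges G)"
  unfolding fin_graph_def by (meson Pow_iff finite_Pow_iff finite_subset subsetI)

lemma finite_verts: "fin_graph G \<Longrightarrow> finite (verts G)"
  unfolding fin_graph_def by simp

lemma sym_adj: "sym (adj G)"
  unfolding adj_def sym_def by (auto simp: insert_commute)

lemma graph_iso_edge:
  assumes "fin_graph G" "graph_iso f G G'" "e \<in> edges G"
  shows "f ` e \<in> edges G'"
proof -
  obtain u v where e: "e = {u, v}" "u \<in> verts G" "v \<in> verts G"
    using assms edge_doubleton by metis
  then show ?thesis using assms unfolding graph_iso_def by auto
qed

lemma graph_iso_edge_surj:
  assumes "fin_graph G'" "graph_iso f G G'" "e \<in> edges G'"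
  obtains e' where "e' \<in> edges G" "f ` e' = e"
proof -
  obtain x y where e: "e = {x, y}" "x \<in> verts G'" "y \<in> verts G'"
    using assms edge_doubleton by metis
  have "verts G' = f ` verts G"
    using assms(2) unfolding graph_iso_def bij_betw_def by simp
  then obtain u v where uv: "u \<in> verts G" "v \<in> verts G" "x = f u" "y = f v"
    using e by auto
  then have "{u, v} \<in> edges G" using assms(2,3) e unfolding graph_iso_def by auto
  then show ?thesis using that uv e by (metis image_empty image_insert)
qed

lemma graph_iso_inv:
  assumes "graph_iso f G G'"
  shows "graph_iso (inv_into (verts G) f) G' G"
proof -
  have b: "bij_betw f (verts G) (verts G')" using assms unfolding graph_iso_def by simp
  let ?g = "inv_into (verts G) f"
  have g: "?g x \<in> verts G" "f (?g x) = x" if "x \<in> verts G'" for x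
    using b that by (auto simp: bij_betw_def inv_into_into f_inv_into_f)
  show ?thesis unfolding graph_iso_def
  proof (intro conjI ballI)
    show "bij_betw ?g (verts G') (verts G)" by (rule bij_betw_inv_into[OF b])
    fix x y assume "x \<in> verts G'" "y \<in> verts G'"
    then show "({x, y} \<in> edges G') = ({?g x, ?g y} \<in> edges G)"
      using assms g unfolding graph_iso_def by metis
  qed
qed

lemma graph_iso_comp:
  assumes "graph_iso f G G'" "graph_iso g G' G''"
  shows "graph_iso (g \<circ> f) G G''"
  using assms unfolding graph_iso_def
  by (auto intro: bij_betw_trans simp: bij_betw_apply)

lemma verts_disjoint_union: "verts (disjoint_union Gs) = (\<Union>i<length Gs. Pair i ` verts (Gs ! i))"
  and edges_disjoint_union:
    "edges (disjoint_union Gs) = (\<Union>i<length Gs. (`) (Pair i) ` edges (Gs ! i))"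
  unfolding disjoint_union_def by auto

lemma fin_graph_disjoint_union:
  assumes "\<And>G. G \<in> set Gs \<Longrightarrow> fin_graph G"
  shows "fin_graph (disjoint_union Gs)"
proof -
  have "finite (verts (disjoint_union Gs))"
    unfolding verts_disjoint_union using assms by (auto simp: fin_graph_def)
  moreover have "e \<subseteq> verts (disjoint_union Gs) \<and> card e = 2"
    if e: "e \<in> edges (disjoint_union Gs)" for e
  proof -
    obtain i e0 where ie: "i < length Gs" "e0 \<in> edges (Gs ! i)" "e = Pair i ` e0"
      using e unfolding edges_disjoint_union by blast
    then have "e0 \<subseteq> verts (Gs ! i)" "card e0 = 2"
      using assms[of "Gs ! i"] unfolding fin_graph_def by auto
    moreover have "card e = card e0" using ie(3) by (auto intro: card_image inj_onI)
    ultimately show ?thesis using ie unfolding verts_disjoint_union by auto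
  qed
  ultimately show ?thesis unfolding fin_graph_def by blast
qed

lemma edge_disjoint_union_iff:
  "{(i, u), (j, v)} \<in> edges (disjoint_union Gs) \<longleftrightarrow>
     i = j \<and> i < length Gs \<and> {u, v} \<in> edges (Gs ! i)"
proof
  assume "{(i, u), (j, v)} \<in> edges (disjoint_union Gs)"
  then obtain k e where k: "k < length Gs" "e \<in> edges (Gs ! k)" "{(i, u), (j, v)} = Pair k ` e"
    unfolding edges_disjoint_union by blast
  have "fst ` {(i, u), (j, v)} \<subseteq> {k}" unfolding k(3) by auto
  then have "i = k" "j = k" by auto
  moreover have "snd ` {(i, u), (j, v)} = e" unfolding k(3) by (simp add: image_image)
  then have "e = {u, v}" by auto
  ultimately show "i = j \<and> i < length Gs \<and> {u, v} \<in> edges (Gs ! i)" using k by auto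
next
  assume *: "i = j \<and> i < length Gs \<and> {u, v} \<in> edges (Gs ! i)"
  then have "{(i, u), (j, v)} = Pair i ` {u, v}" by auto
  then show "{(i, u), (j, v)} \<in> edges (disjoint_union Gs)"
    using * unfolding edges_disjoint_union by blast
qed

lemma graph_iso_image_iff:
  assumes "fin_graph G"
  shows "graph_iso f G (graph_image f G) \<longleftrightarrow> inj_on f (verts G)"
proof
  show "graph_iso f G (graph_image f G) \<Longrightarrow> inj_on f (verts G)"
    unfolding graph_iso_def bij_betw_def by simp
next
  assume inj: "inj_on f (verts G)"
  have "{u, v} \<in> edges G" if u: "u \<in> verts G" "v \<in> verts G" and fe: "{f u, f v} \<in> (`) f ` edges G" for u v
  proof -
    obtain e where e: "e \<in> edges G" "{f u, f v} = f ` e" using fe by blast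
    then have "e \<subseteq> verts G" using assms unfolding fin_graph_def by auto
    then have "e = {u, v}"
      using inj_on_image_eq_iff[OF inj, of e "{u, v}"] e(2) u by auto
    then show ?thesis using e by simp
  qed
  moreover have "{f u, f v} \<in> (`) f ` edges G" if "{u, v} \<in> edges G" for u v
    using imageI[OF that, of "(`) f"] by simp
  ultimately show "graph_iso f G (graph_image f G)"
    using inj unfolding graph_iso_def graph_image_def bij_betw_def by auto
qed

lemma fin_graph_image_hom:
  assumes "fin_graph G" "fin_graph H" "graph_hom f G H"
  shows "subgraph (graph_image f G) H"
  using assms unfolding subgraph_def graph_hom_def graph_image_def fin_graph_def by auto

lemma rtrancl_adj_verts:
  assumes "fin_graph G" "u \<in> verts G" "(u, v) \<in> (adj G)\<^sup>*"
  shows "v \<in> verts G"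
  using assms(3,2) by (induction rule: rtrancl_induct) (auto simp: adj_def dest: edge_verts[OF assms(1)])

lemma adj_mono: "edges K \<subseteq> edges G \<Longrightarrow> (adj K)\<^sup>* \<subseteq> (adj G)\<^sup>*"
  unfolding adj_def by (intro rtrancl_mono) auto

text \<open>Membership in a common component is replaced by reachability, so that components never have
  to be exhibited later on.\<close>

lemma weak_induced_iff:
  "weak_induced_subgraph K H \<longleftrightarrow> subgraph K H \<and>
     (\<forall>u\<in>verts K. \<forall>v. (u, v) \<in> (adj K)\<^sup>* \<longrightarrow> {u, v} \<in> edges H \<longrightarrow> {u, v} \<in> edges K)"
  (is "_ \<longleftrightarrow> subgraph K H \<and> ?R")
proof -
  have "?R" if w: "weak_induced_subgraph K H"
  proof (intro ballI allI impI)
    fix u v assume u: "u \<in> verts K" and uv: "(u, v) \<in> (adj K)\<^sup>*" "{u, v} \<in> edges H"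
    have K: "fin_graph K" using w unfolding weak_induced_subgraph_def subgraph_def by simp
    define V where "V = {w. (u, w) \<in> (adj K)\<^sup>*}"
    define C where "C = Graph V {e \<in> edges K. e \<subseteq> V}"
    have VK: "V \<subseteq> verts K" using rtrancl_adj_verts[OF K u] unfolding V_def by auto
    have C: "subgraph C K"
      using K VK finite_subset[OF VK] unfolding subgraph_def C_def fin_graph_def by auto
    have reach: "(u, w) \<in> (adj C)\<^sup>*" if "w \<in> V" for w
      using that unfolding V_def mem_Collect_eq
    proof (induction rule: rtrancl_induct)
      case (step y z)
      then have "z \<in> V" "y \<in> V" unfolding V_def by (auto intro: rtrancl_into_rtrancl)
      then have "(y, z) \<in> adj C" using step(2) unfolding adj_def C_def by auto
      then show ?case using step by (simp add: rtrancl_into_rtrancl)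
    qed simp
    have "connected_graph C" unfolding connected_graph_def
    proof (intro conjI ballI)
      show "verts C \<noteq> {}" unfolding C_def V_def by auto
      fix x y assume "x \<in> verts C" "y \<in> verts C"
      then have "(u, x) \<in> (adj C)\<^sup>*" "(u, y) \<in> (adj C)\<^sup>*" using reach unfolding C_def by auto
      moreover have "(x, u) \<in> (adj C)\<^sup>*"
        using sym_rtrancl[OF sym_adj] calculation(1) by (metis symE)
      ultimately show "(x, y) \<in> (adj C)\<^sup>*" by simp
    qed
    moreover have "K' = C" if K': "subgraph K' K" "connected_graph K'" "subgraph C K'" for K'
    proof -
      have "u \<in> verts K'" using K'(3) unfolding subgraph_def C_def V_def by auto
      then have "verts K' \<subseteq> V"
        using K'(1,2) adj_mono[of K' K] unfolding connected_graph_def V_def subgraph_def by blast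
      moreover have "edges K' \<subseteq> edges C"
        using K'(1) calculation unfolding C_def subgraph_def fin_graph_def by fastforce
      ultimately show ?thesis
        using K'(3) unfolding subgraph_def C_def by (cases K') auto
    qed
    ultimately have "component C K" using C unfolding component_def by blast
    then have "induced_subgraph C H" using w unfolding weak_induced_subgraph_def by blast
    moreover have "{u, v} \<subseteq> V" using uv unfolding V_def by auto
    ultimately show "{u, v} \<in> edges K"
      using uv(2) unfolding induced_subgraph_def C_def by auto
  qed
  moreover have "induced_subgraph C H" if s: "subgraph K H" and R: "?R" and c: "component C K" for C
  proof -
    have CK: "subgraph C K" and con: "connected_graph C"
      and mx: "\<And>K'. subgraph K' K \<Longrightarrow> connected_graph K' \<Longrightarrow> subgraph C K' \<Longrightarrow> K' = C"
      using c unfolding component_def by auto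
    have "e \<in> edges C" if e: "e \<in> edges H" "e \<subseteq> verts C" for e
    proof -
      obtain u v where uv: "e = {u, v}" using e s edge_doubleton unfolding subgraph_def by metis
      then have "(u, v) \<in> (adj C)\<^sup>*" "u \<in> verts K"
        using con e CK unfolding connected_graph_def subgraph_def by auto
      then have "(u, v) \<in> (adj K)\<^sup>*" using adj_mono[of C K] CK unfolding subgraph_def by auto
      then have eK: "e \<in> edges K" using R uv e(1) \<open>u \<in> verts K\<close> by auto
      \<comment> \<open>Adding \<open>e\<close> to \<open>C\<close> keeps it connected, so the maximality of \<open>C\<close> applies.\<close>
      define C' where "C' = Graph (verts C) (insert e (edges C))"
      have "subgraph C' K" "subgraph C C'"
        using CK eK e(2) unfolding subgraph_def C'_def fin_graph_def by auto
      moreover have "connected_graph C'"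
        using con adj_mono[of C C'] unfolding connected_graph_def C'_def by auto
      ultimately have "C' = C" using mx by blast
      then show ?thesis unfolding C'_def by (metis graph.sel(2) insertI1)
    qed
    moreover have "subgraph C H" using s CK unfolding subgraph_def by blast
    moreover have "e \<subseteq> verts C" if "e \<in> edges C" for e
      using that CK unfolding subgraph_def fin_graph_def by blast
    ultimately show ?thesis unfolding induced_subgraph_def subgraph_def by blast
  qed
  ultimately show ?thesis unfolding weak_induced_subgraph_def by blast
qed

section \<open>Comparing the covering numbers\<close>

lemma cover_iff:
  "cover \<G> H Gs \<phi> \<longleftrightarrow> set Gs \<subseteq> \<G> \<and>
     (\<forall>i<length Gs. graph_hom (guest_map \<phi> i) (Gs ! i) H) \<and>
     (\<forall>e\<in>edges H. \<exists>i<length Gs. \<exists>e'\<in>edges (Gs ! i). guest_map \<phi> i ` e' = e)"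
proof -
  have im: "\<phi> ` Pair i ` e = guest_map \<phi> i ` e" for i e
    unfolding guest_map_def by (simp add: image_image)
  have "graph_hom \<phi> (disjoint_union Gs) H \<longleftrightarrow> (\<forall>i<length Gs. graph_hom (guest_map \<phi> i) (Gs ! i) H)"
    unfolding graph_hom_def edges_disjoint_union verts_disjoint_union image_UN im UN_subset_iff by (auto simp: im)
  moreover have "(\<exists>e'\<in>edges (disjoint_union Gs). \<phi> ` e' = e) \<longleftrightarrow>
      (\<exists>i<length Gs. \<exists>e'\<in>edges (Gs ! i). guest_map \<phi> i ` e' = e)" for e
    proof -
    have "(\<exists>e'\<in>edges (disjoint_union Gs). \<phi> ` e' = e) \<longleftrightarrow>
        (\<exists>i<length Gs. \<exists>e'\<in>edges (Gs ! i). \<phi> ` Pair i ` e' = e)"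
      unfolding edges_disjoint_union by blast
    then show ?thesis unfolding im .
  qed
  ultimately show ?thesis unfolding cover_def by simp
qed

lemma injective_cover_iff:
  assumes "\<And>G. G \<in> set Gs \<Longrightarrow> fin_graph G"
  shows "injective_cover Gs \<phi> \<longleftrightarrow> (\<forall>i<length Gs. inj_on (guest_map \<phi> i) (verts (Gs ! i)))"
  unfolding injective_cover_def using assms by (simp add: graph_iso_image_iff)

lemma fin_graph_disjoint_unions: "U \<in> disjoint_unions \<G> \<Longrightarrow> fin_graph U"
  unfolding disjoint_unions_def by simp

text \<open>The parts of the disjoint unions become the guests. Two points of one fibre lie in different
  unions, because the cover is injective on each union. No edge of a union joins two of its parts,
  so a part inherits from its union that the image is weak induced.\<close>

lemma union_cover_to_local_cover:
  assumes \<G>: "graph_class \<G>"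
    and cov: "cover (disjoint_unions \<G>) H Us \<phi>" and inj: "injective_cover Us \<phi>"
  obtains Gs \<psi> where "cover \<G> H Gs \<psi>" "injective_cover Gs \<psi>" "fibres_le H Gs \<psi> (length Us)"
    "weak_induced_cover H Us \<phi> \<Longrightarrow> weak_induced_cover H Gs \<psi>"
proof -
  have finU: "fin_graph (Us ! i)" if "i < length Us" for i
    using cov that fin_graph_disjoint_unions unfolding cover_def by (metis nth_mem subsetD)
  have "\<exists>Gs f. set Gs \<subseteq> \<G> \<and> graph_iso f (disjoint_union Gs) (Us ! i)" if "i < length Us" for i
  proof -
    have "Us ! i \<in> disjoint_unions \<G>" using cov that unfolding cover_def by (meson nth_mem subsetD)
    then show ?thesis unfolding disjoint_unions_def isomorphic_def by blast
  qed
  then obtain P f where P: "\<And>i. i < length Us \<Longrightarrow> set (P i) \<subseteq> \<G>"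
    and f: "\<And>i. i < length Us \<Longrightarrow> graph_iso (f i) (disjoint_union (P i)) (Us ! i)"
    by metis
  define J where "J = (SIGMA i:{..<length Us}. {..<length (P i)})"
  have "finite J" unfolding J_def by auto
  then obtain js where js: "set js = J" "distinct js" using finite_distinct_list by blast
  define Gs where "Gs = map (\<lambda>(i, m). P i ! m) js"
  define \<psi> where "\<psi> = (\<lambda>(k, v). guest_map \<phi> (fst (js ! k)) (f (fst (js ! k)) (snd (js ! k), v)))"
  have len: "length Gs = length js" unfolding Gs_def by simp
  have idx: "\<exists>i m. js ! k = (i, m) \<and> i < length Us \<and> m < length (P i) \<and> Gs ! k = P i ! m \<and>
      guest_map \<psi> k = guest_map \<phi> i \<circ> f i \<circ> Pair m" if k: "k < length js" for k
  proof -
    obtain i m where im: "js ! k = (i, m)" by fastforce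
    then have "i < length Us" "m < length (P i)" using k js(1) nth_mem unfolding J_def by fastforce+
    then show ?thesis using im k unfolding Gs_def \<psi>_def guest_map_def by auto
  qed
  have PG: "P i ! m \<in> \<G>" "fin_graph (P i ! m)" if "i < length Us" "m < length (P i)" for i m
    using P that \<G> unfolding graph_class_def by (meson nth_mem subsetD)+
  have finDU: "fin_graph (disjoint_union (P i))" if "i < length Us" for i
    using P[OF that] \<G> unfolding graph_class_def by (intro fin_graph_disjoint_union) auto
  have Gs: "set Gs \<subseteq> \<G>"
    unfolding in_set_conv_nth subset_iff len by (metis idx PG(1) in_set_conv_nth len)
  have finG: "\<And>G. G \<in> set Gs \<Longrightarrow> fin_graph G" using Gs \<G> unfolding graph_class_def by auto
  have part_vert: "f i (m, v) \<in> verts (Us ! i)"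
    if "i < length Us" "m < length (P i)" "v \<in> verts (P i ! m)" for i m v
  proof -
    have "(m, v) \<in> verts (disjoint_union (P i))" using that unfolding disjoint_union_def by auto
    then show ?thesis using f[OF that(1)] bij_betw_apply unfolding graph_iso_def by metis
  qed
  have part_edge: "f i ` Pair m ` e \<in> edges (Us ! i)"
    if "i < length Us" "m < length (P i)" "e \<in> edges (P i ! m)" for i m e
  proof -
    have "Pair m ` e \<in> edges (disjoint_union (P i))" using that unfolding disjoint_union_def by auto
    then show ?thesis using f finDU graph_iso_edge that(1) by metis
  qed
  have part_edge_iff: "{f i (m, u), f i (m', v)} \<in> edges (Us ! i) \<longleftrightarrow> m = m' \<and> {u, v} \<in> edges (P i ! m)"
    if "i < length Us" "m < length (P i)" "u \<in> verts (P i ! m)" "m' < length (P i)" "v \<in> verts (P i ! m')"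
    for i m m' u v
  proof -
    have "(m, u) \<in> verts (disjoint_union (P i))" "(m', v) \<in> verts (disjoint_union (P i))"
      using that unfolding disjoint_union_def by auto
    then have "{f i (m, u), f i (m', v)} \<in> edges (Us ! i) \<longleftrightarrow> {(m, u), (m', v)} \<in> edges (disjoint_union (P i))"
      using f[OF that(1)] unfolding graph_iso_def by auto
    then show ?thesis using that by (auto simp: edge_disjoint_union_iff)
  qed
  have homU: "graph_hom (guest_map \<phi> i) (Us ! i) H" if "i < length Us" for i
    using cov that unfolding cover_iff by blast
  have covU: "\<exists>i<length Us. \<exists>e'\<in>edges (Us ! i). guest_map \<phi> i ` e' = e" if "e \<in> edges H" for e
    using cov that by (simp add: cover_iff)
  have injU: "inj_on (guest_map \<phi> i) (verts (Us ! i))" if "i < length Us" for i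
    using inj that finU unfolding injective_cover_def by (metis graph_iso_image_iff)
  have inj_part: "(m, u) = (m', v)"
    if "guest_map \<phi> i (f i (m, u)) = guest_map \<phi> i (f i (m', v))" "i < length Us" "m < length (P i)"
      "u \<in> verts (P i ! m)" "m' < length (P i)" "v \<in> verts (P i ! m')" for i m m' u v
  proof -
    have "f i (m, u) = f i (m', v)"
      using inj_onD[OF injU] part_vert that by metis
    moreover have "(m, u) \<in> verts (disjoint_union (P i))" "(m', v) \<in> verts (disjoint_union (P i))"
      using that unfolding disjoint_union_def by auto
    ultimately show ?thesis using f[OF that(2)] unfolding graph_iso_def bij_betw_def
      by (meson inj_onD)
  qed
  have "graph_hom (guest_map \<psi> k) (Gs ! k) H" if k: "k < length Gs" for k
  proof -
    obtain i m where im: "i < length Us" "m < length (P i)" "Gs ! k = P i ! m"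
      "guest_map \<psi> k = guest_map \<phi> i \<circ> f i \<circ> Pair m" using idx k len by metis
    show ?thesis
      unfolding graph_hom_def im(3,4)
    proof (intro conjI ballI subsetI)
      fix x assume "x \<in> (guest_map \<phi> i \<circ> f i \<circ> Pair m) ` verts (P i ! m)"
      then show "x \<in> verts H"
        using homU[OF im(1)] part_vert[OF im(1,2)] unfolding graph_hom_def by auto
    next
      fix e assume "e \<in> edges (P i ! m)"
      then have "f i ` Pair m ` e \<in> edges (Us ! i)" by (rule part_edge[OF im(1,2)])
      then have "guest_map \<phi> i ` f i ` Pair m ` e \<in> edges H"
        using homU[OF im(1)] unfolding graph_hom_def by simp
      then show "(guest_map \<phi> i \<circ> f i \<circ> Pair m) ` e \<in> edges H"
        by (simp add: image_comp comp_assoc)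
    qed
  qed
  moreover have "\<exists>k<length Gs. \<exists>e'\<in>edges (Gs ! k). guest_map \<psi> k ` e' = e" if e: "e \<in> edges H" for e
  proof -
    obtain i e1 where 1: "i < length Us" "e1 \<in> edges (Us ! i)" "guest_map \<phi> i ` e1 = e"
      using covU[OF e] by auto
    obtain e2 where 2: "e2 \<in> edges (disjoint_union (P i))" "f i ` e2 = e1"
      using graph_iso_edge_surj finU f 1 by metis
    obtain m e3 where 3: "m < length (P i)" "e3 \<in> edges (P i ! m)" "e2 = Pair m ` e3"
      using 2(1) unfolding disjoint_union_def by auto
    have "(i, m) \<in> set js" using js 1 3 unfolding J_def by auto
    then obtain k where k: "k < length js" "js ! k = (i, m)" by (metis in_set_conv_nth)
    then have Gk: "Gs ! k = P i ! m" "guest_map \<psi> k = guest_map \<phi> i \<circ> f i \<circ> Pair m"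
      using idx[OF k(1)] by auto
    have "guest_map \<psi> k ` e3 = e"
      unfolding Gk(2) 1(3)[symmetric] 2(2)[symmetric] 3(3) by (simp add: image_comp comp_assoc)
    then show ?thesis using 3 k len Gk by metis
  qed
  ultimately have "cover \<G> H Gs \<psi>" unfolding cover_iff using Gs by blast
  moreover have "\<forall>k<length Gs. inj_on (guest_map \<psi> k) (verts (Gs ! k))"
  proof (intro allI impI inj_onI)
    fix k u v assume k: "k < length Gs" and u: "u \<in> verts (Gs ! k)" "v \<in> verts (Gs ! k)"
      and eq: "guest_map \<psi> k u = guest_map \<psi> k v"
    obtain i m where im: "i < length Us" "m < length (P i)" "Gs ! k = P i ! m"
      "guest_map \<psi> k = guest_map \<phi> i \<circ> f i \<circ> Pair m" using idx k len by metis
    show "u = v" using inj_part[of i m u m v] eq u im by auto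
  qed
  then have "injective_cover Gs \<psi>" using injective_cover_iff finG by blast
  moreover have "fibres_le H Gs \<psi> (length Us)" unfolding fibres_le_def
  proof
    fix v assume "v \<in> verts H"
    let ?F = "{w \<in> verts (disjoint_union Gs). \<psi> w = v}"
    have "inj_on (\<lambda>(k, u). fst (js ! k)) ?F"
    proof (rule inj_onI, clarify)
      fix k u k' u'
      assume a: "(k, u) \<in> verts (disjoint_union Gs)" "(k', u') \<in> verts (disjoint_union Gs)"
        and eq: "fst (js ! k) = fst (js ! k')" "\<psi> (k', u') = \<psi> (k, u)"
      have k: "k < length js" "k' < length js" "u \<in> verts (Gs ! k)" "u' \<in> verts (Gs ! k')"
        using a len unfolding disjoint_union_def by auto
      obtain i m where im: "i < length Us" "m < length (P i)" "Gs ! k = P i ! m" "js ! k = (i, m)"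
        "guest_map \<psi> k = guest_map \<phi> i \<circ> f i \<circ> Pair m" using idx k by metis
      obtain i' m' where im': "m' < length (P i')" "Gs ! k' = P i' ! m'" "js ! k' = (i', m')"
        "guest_map \<psi> k' = guest_map \<phi> i' \<circ> f i' \<circ> Pair m'" using idx k by metis
      have i: "i' = i" using eq im im' by simp
      have "guest_map \<psi> k u = guest_map \<psi> k' u'" using eq unfolding guest_map_def by simp
      then have "(m, u) = (m', u')" using inj_part[of i m u m' u'] im im' k i by auto
      then have "js ! k = js ! k'" "u = u'" using im im' i by auto
      then show "k = k' \<and> u = u'" using js(2) k by (simp add: nth_eq_iff_index_eq)
    qed
    moreover have "(\<lambda>(k, u). fst (js ! k)) ` ?F \<subseteq> {..<length Us}"
    proof (rule image_subsetI)
      fix w assume "w \<in> ?F"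
      then obtain k u where w: "w = (k, u)" "k < length js" using len unfolding disjoint_union_def by auto
      then show "(case w of (k, u) \<Rightarrow> fst (js ! k)) \<in> {..<length Us}" using idx by fastforce
    qed
    ultimately have "card ?F \<le> card {..<length Us}" using card_inj_on_le finite_lessThan by blast
    then show "card ?F \<le> length Us" by simp
  qed
  moreover have "weak_induced_cover H Gs \<psi>" if wi: "weak_induced_cover H Us \<phi>"
    unfolding weak_induced_cover_def
  proof (intro allI impI)
    fix k assume "k < length Gs"
    then obtain i m where im: "i < length Us" "m < length (P i)" "Gs ! k = P i ! m"
      "guest_map \<psi> k = guest_map \<phi> i \<circ> f i \<circ> Pair m" using idx len by metis
    let ?U = "graph_image (guest_map \<phi> i) (Us ! i)"
    let ?K = "graph_image (guest_map \<psi> k) (Gs ! k)"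
    have wiU: "subgraph ?U H"
      "\<And>u v. u \<in> verts ?U \<Longrightarrow> (u, v) \<in> (adj ?U)\<^sup>* \<Longrightarrow> {u, v} \<in> edges H \<Longrightarrow> {u, v} \<in> edges ?U"
      using wi im(1) unfolding weak_induced_cover_def weak_induced_iff by blast+
    have vK: "verts ?K = (\<lambda>v. guest_map \<phi> i (f i (m, v))) ` verts (P i ! m)"
      unfolding graph_image_def im(3,4) by (simp add: o_def)
    have eK: "edges ?K = (\<lambda>e. guest_map \<phi> i ` (f i ` Pair m ` e)) ` edges (P i ! m)"
      unfolding graph_image_def im(3,4) by (simp add: image_comp comp_assoc)
    have KU: "verts ?K \<subseteq> verts ?U" "edges ?K \<subseteq> edges ?U"
      using part_vert[OF im(1,2)] part_edge[OF im(1,2)] unfolding vK eK by (auto simp: graph_image_def)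
    have "fin_graph ?K"
      unfolding fin_graph_def
    proof (intro conjI ballI)
      show "finite (verts ?K)" unfolding vK using PG(2)[OF im(1,2)] finite_verts by auto
      fix e assume e: "e \<in> edges ?K"
      then show "card e = 2" using KU wiU(1) unfolding subgraph_def fin_graph_def by blast
      obtain e0 where e0: "e0 \<in> edges (P i ! m)" "e = guest_map \<phi> i ` (f i ` Pair m ` e0)"
        using e unfolding eK by auto
      have "e0 \<subseteq> verts (P i ! m)" using e0 PG(2)[OF im(1,2)] unfolding fin_graph_def by auto
      then show "e \<subseteq> verts ?K" unfolding vK e0(2) by auto
    qed
    then have sub: "subgraph ?K H" using KU wiU(1) unfolding subgraph_def by auto
    have "{x, y} \<in> edges ?K"
      if x: "x \<in> verts ?K" and xy: "(x, y) \<in> (adj ?K)\<^sup>*" "{x, y} \<in> edges H" for x y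
    proof -
      have y: "y \<in> verts ?K" using rtrancl_adj_verts[OF \<open>fin_graph ?K\<close> x xy(1)] .
      have "{x, y} \<in> edges ?U" using wiU(2) KU x xy adj_mono by blast
      then obtain e where e: "e \<in> edges (Us ! i)" "{x, y} = guest_map \<phi> i ` e"
        unfolding graph_image_def by auto
      obtain u v where uv: "x = guest_map \<phi> i (f i (m, u))" "y = guest_map \<phi> i (f i (m, v))"
        "u \<in> verts (P i ! m)" "v \<in> verts (P i ! m)" using x y unfolding vK by auto
      have "guest_map \<phi> i ` e = guest_map \<phi> i ` {f i (m, u), f i (m, v)}" using e(2) uv by auto
      moreover have "e \<subseteq> verts (Us ! i)" using e(1) finU im unfolding fin_graph_def by auto
      ultimately have "e = {f i (m, u), f i (m, v)}"
        using inj_on_image_eq_iff[OF injU] part_vert im uv by (metis empty_subsetI insert_subset)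
      then have "{u, v} \<in> edges (P i ! m)" using e(1) part_edge_iff im uv by auto
      then have "guest_map \<phi> i ` (f i ` Pair m ` {u, v}) \<in> edges ?K" unfolding eK by blast
      then show ?thesis using uv by simp
    qed
    then show "weak_induced_subgraph ?K H" unfolding weak_induced_iff using sub by blast
  qed
  ultimately show thesis using that by blast
qed

lemma fibres_le_mono: "fibres_le H Gs \<phi> k \<Longrightarrow> k \<le> l \<Longrightarrow> fibres_le H Gs \<phi> l"
  unfolding fibres_le_def by (meson order_trans)

lemma c_union_le:
  "cover (disjoint_unions \<G>) H Gs \<phi> \<Longrightarrow> injective_cover Gs \<phi> \<Longrightarrow> c_union \<G> H \<le> enat (length Gs)"
  unfolding c_union_def by (rule Inf_lower) blast

lemma ic_union_le:
  "cover (disjoint_unions \<G>) H Gs \<phi> \<Longrightarrow> injective_cover Gs \<phi> \<Longrightarrow> weak_induced_cover H Gs \<phi>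
    \<Longrightarrow> ic_union \<G> H \<le> enat (length Gs)"
  unfolding ic_union_def by (rule Inf_lower) blast

lemma c_local_le:
  "cover \<G> H Gs \<phi> \<Longrightarrow> injective_cover Gs \<phi> \<Longrightarrow> fibres_le H Gs \<phi> l \<Longrightarrow> c_local \<G> H \<le> enat l"
  unfolding c_local_def by (rule Inf_lower) blast

lemma ic_local_le:
  "cover \<G> H Gs \<phi> \<Longrightarrow> injective_cover Gs \<phi> \<Longrightarrow> weak_induced_cover H Gs \<phi> \<Longrightarrow>
    fibres_le H Gs \<phi> l \<Longrightarrow> ic_local \<G> H \<le> enat l"
  unfolding ic_local_def by (rule Inf_lower) blast

lemma c_folded_le_local: "c_folded \<G> H \<le> c_local \<G> H"
  and ic_folded_le_local: "ic_folded \<G> H \<le> ic_local \<G> H"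
  unfolding c_folded_def c_local_def ic_folded_def ic_local_def
  by (rule Inf_superset_mono; blast)+

lemma local_le_union:
  assumes "graph_class \<G>"
  shows "c_local \<G> H \<le> c_union \<G> H" and "ic_local \<G> H \<le> ic_union \<G> H"
proof -
  show "c_local \<G> H \<le> c_union \<G> H"
    unfolding c_union_def
  proof (rule Inf_greatest, clarify)
    fix Us and \<phi> :: "nat \<times> nat \<Rightarrow> 'a"
    assume "cover (disjoint_unions \<G>) H Us \<phi>" "injective_cover Us \<phi>"
    then show "c_local \<G> H \<le> enat (length Us)"
      using union_cover_to_local_cover[OF assms, of H Us \<phi>] c_local_le by metis
  qed
  show "ic_local \<G> H \<le> ic_union \<G> H"
    unfolding ic_union_def
  proof (rule Inf_greatest, clarify)
    fix Us and \<phi> :: "nat \<times> nat \<Rightarrow> 'a"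
    assume "cover (disjoint_unions \<G>) H Us \<phi>" "injective_cover Us \<phi>" "weak_induced_cover H Us \<phi>"
    then show "ic_local \<G> H \<le> enat (length Us)"
      using union_cover_to_local_cover[OF assms, of H Us \<phi>] ic_local_le by metis
  qed
qed

lemma covering_numbers_between:
  assumes "graph_class \<G>"
  shows "c_folded \<G> H \<le> c_num x \<G> H" "c_num x \<G> H \<le> c_union \<G> H"
    "ic_folded \<G> H \<le> ic_num x \<G> H" "ic_num x \<G> H \<le> ic_union \<G> H"
  using local_le_union[OF assms, of H] c_folded_le_local[of \<G> H] ic_folded_le_local[of \<G> H]
  by (cases x; force)+

lemma c_folded_cover:
  assumes "c_folded \<G> H \<le> enat k"
  obtains Gs \<phi> where "cover \<G> H Gs \<phi>" "fibres_le H Gs \<phi> k"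
proof -
  let ?A = "{enat l | l Gs \<phi>. cover \<G> H Gs \<phi> \<and> fibres_le H Gs \<phi> l}"
  have "?A \<noteq> {}"
  proof
    assume "?A = {}"
    then have "c_folded \<G> H = \<infinity>" unfolding c_folded_def Inf_enat_def by presburger
    then show False using assms by simp
  qed
  then obtain z where "z \<in> ?A" unfolding ex_in_conv[symmetric] by (elim exE)
  then have "c_folded \<G> H \<in> ?A" unfolding c_folded_def by (rule wellorder_InfI)
  then obtain l Gs \<phi> where "c_folded \<G> H = enat l" "cover \<G> H Gs \<phi>" "fibres_le H Gs \<phi> l"
    by (elim CollectE exE conjE)
  then show thesis using that assms fibres_le_mono[of H Gs \<phi> l k] by simp
qed

lemma ic_folded_geI:
  assumes "\<And>Gs \<phi> l. cover \<G> H Gs \<phi> \<Longrightarrow> weak_induced_cover H Gs \<phi> \<Longrightarrow> fibres_le H Gs \<phi> l \<Longrightarrow> m \<le> enat l"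
  shows "m \<le> ic_folded \<G> H"
  unfolding ic_folded_def using assms by (intro Inf_greatest) blast

lemma in_disjoint_unions:
  assumes "G \<in> \<G>" "fin_graph G"
  shows "G \<in> disjoint_unions \<G>"
proof -
  have "graph_iso snd (disjoint_union [G]) G"
    unfolding graph_iso_def bij_betw_def
    by (auto simp: verts_disjoint_union inj_on_def edge_disjoint_union_iff image_iff)
  then have "isomorphic (disjoint_union [G]) G" unfolding isomorphic_def by blast
  then show ?thesis
    using assms unfolding disjoint_unions_def by (intro CollectI conjI exI[of _ "[G]"]) auto
qed

text \<open>Guests and hosts both have vertices in \<open>nat\<close>, so subgraphs of the host can serve as guests
  with the identity as cover map.\<close>

lemma subgraph_family_cover:
  fixes H :: "nat graph" and K :: "'i \<Rightarrow> nat graph"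
  assumes I: "finite I"
    and K: "\<And>i. i \<in> I \<Longrightarrow> K i \<in> disjoint_unions \<G>"
    and sub: "\<And>i. i \<in> I \<Longrightarrow> subgraph (K i) H"
    and cov: "edges H \<subseteq> (\<Union>i\<in>I. edges (K i))"
  shows "c_union \<G> H \<le> enat (card I)"
    and "(\<And>i. i \<in> I \<Longrightarrow> weak_induced_subgraph (K i) H) \<Longrightarrow> ic_union \<G> H \<le> enat (card I)"
proof -
  obtain xs where xs: "set xs = I" "distinct xs" using finite_distinct_list[OF I] by blast
  define Gs where "Gs = map K xs"
  have len: "length Gs = card I" unfolding Gs_def using xs distinct_card by fastforce
  have Ki: "\<exists>i\<in>I. Gs ! n = K i" if "n < length Gs" for n
    using that xs nth_mem[of n xs] unfolding Gs_def by auto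
  have g: "guest_map snd n = id" for n :: nat unfolding guest_map_def by auto
  have im: "graph_image id G = G" for G :: "nat graph" unfolding graph_image_def by (cases G) auto
  have "set Gs \<subseteq> disjoint_unions \<G>" using K xs unfolding Gs_def by auto
  moreover have "graph_hom id (Gs ! n) H" if n: "n < length Gs" for n
  proof -
    obtain i where "i \<in> I" "Gs ! n = K i" using Ki[OF n] by blast
    then show ?thesis using sub[of i] unfolding graph_hom_def subgraph_def by auto
  qed
  moreover have "\<exists>n<length Gs. \<exists>e'\<in>edges (Gs ! n). id ` e' = e" if e: "e \<in> edges H" for e
  proof -
    obtain i where "i \<in> set xs" "e \<in> edges (K i)" using e cov xs by auto
    then show ?thesis unfolding Gs_def by (auto simp: in_set_conv_nth)
  qed
  ultimately have c: "cover (disjoint_unions \<G>) H Gs snd" unfolding cover_iff g by blast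
  moreover have "injective_cover Gs snd"
    using c fin_graph_disjoint_unions unfolding cover_def
    by (subst injective_cover_iff) (auto simp: g)
  ultimately show "c_union \<G> H \<le> enat (card I)"
    and "(\<And>i. i \<in> I \<Longrightarrow> weak_induced_subgraph (K i) H) \<Longrightarrow> ic_union \<G> H \<le> enat (card I)"
    using c_union_le[of \<G> H Gs snd] ic_union_le[of \<G> H Gs snd] Ki
    unfolding weak_induced_cover_def g im len by metis+
qed

section \<open>Sparse hosts\<close>

text \<open>Bounded maximum average degree in the form used for counting. The bound is on edges per vertex,
  that is, on half the average degree.\<close>

definition sparse :: "nat \<Rightarrow> 'a graph \<Rightarrow> bool" where
  "sparse d G \<longleftrightarrow> (\<forall>W\<subseteq>verts G. card {e \<in> edges G. e \<subseteq> W} \<le> d * card W)"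

lemma mad_le_imp_sparse:
  assumes G: "fin_graph G" and "mad G \<le> real d"
  shows "sparse d G"
  unfolding sparse_def
proof (intro allI impI)
  fix W assume W: "W \<subseteq> verts G"
  have finW: "finite W" using W finite_verts[OF G] finite_subset by blast
  let ?E = "{e \<in> edges G. e \<subseteq> W}"
  show "card ?E \<le> d * card W"
  proof (cases "W = {}")
    case True
    then have "?E = {}" using G unfolding fin_graph_def by fastforce
    then have "card ?E = 0" by (simp only: card.empty)
    then show ?thesis by simp
  next
    case False
    let ?q = "\<lambda>K. 2 * real (card (edges K)) / real (card (verts K))"
    let ?M = "{?q K | K. subgraph K G \<and> card (verts K) \<ge> 1}"
    have "?M \<subseteq> (\<lambda>(V, E). ?q (Graph V E)) ` (Pow (verts G) \<times> Pow (edges G))"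
    proof
      fix q assume "q \<in> ?M"
      then obtain K where "q = ?q K" "subgraph K G" by blast
      then show "q \<in> (\<lambda>(V, E). ?q (Graph V E)) ` (Pow (verts G) \<times> Pow (edges G))"
        unfolding subgraph_def by (intro image_eqI[of _ _ "(verts K, edges K)"]) auto
    qed
    then have finM: "finite ?M"
      by (rule finite_subset) (use finite_verts[OF G] finite_edges[OF G] in auto)
    have "subgraph (Graph W ?E) G"
      using W G finW unfolding subgraph_def fin_graph_def by auto
    moreover have cW: "card W \<ge> 1" using False finW by (simp add: Suc_leI card_gt_0_iff)
    ultimately have "?q (Graph W ?E) \<in> ?M" by (intro CollectI exI[of _ "Graph W ?E"]) simp
    then have "?q (Graph W ?E) \<le> Max ?M" using finM by (rule Max_ge[rotated])
    moreover have "verts G \<noteq> {}" using False W by auto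
    ultimately have "?q (Graph W ?E) \<le> real d" using assms(2) unfolding mad_def by auto
    then have "2 * real (card ?E) \<le> real d * real (card W)"
      using cW by (simp add: divide_le_eq)
    then have "real (card ?E) \<le> real (d * card W)" by simp
    then show ?thesis by (simp only: of_nat_le_iff)
  qed
qed

lemma sparse_disjoint_union:
  assumes "\<And>G. G \<in> set Gs \<Longrightarrow> fin_graph G" "\<And>G. G \<in> set Gs \<Longrightarrow> sparse d G"
  shows "sparse d (disjoint_union Gs)"
  unfolding sparse_def
proof (intro allI impI)
  fix W assume W: "W \<subseteq> verts (disjoint_union Gs)"
  define P where "P i = {v. (i, v) \<in> W}" for i
  have P: "P i \<subseteq> verts (Gs ! i)" if "i < length Gs" for i
    using W unfolding P_def verts_disjoint_union by auto
  have Weq: "W = (SIGMA i:{..<length Gs}. P i)"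
    using W unfolding P_def verts_disjoint_union by auto
  have finP: "finite (P i)" if "i < length Gs" for i
    using P[OF that] assms(1) that finite_subset finite_verts by (metis nth_mem)
  let ?E = "\<lambda>i. {e \<in> edges (Gs ! i). e \<subseteq> P i}"
  have "{e \<in> edges (disjoint_union Gs). e \<subseteq> W} \<subseteq> (\<Union>i<length Gs. (`) (Pair i) ` ?E i)"
  proof
    fix e assume "e \<in> {e \<in> edges (disjoint_union Gs). e \<subseteq> W}"
    then obtain i e0 where "i < length Gs" "e0 \<in> edges (Gs ! i)" "e = Pair i ` e0" "e \<subseteq> W"
      unfolding edges_disjoint_union by blast
    then show "e \<in> (\<Union>i<length Gs. (`) (Pair i) ` ?E i)" unfolding P_def by blast
  qed
  moreover have finE: "finite (?E i)" if "i < length Gs" for i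
    using finite_edges[OF assms(1)[OF nth_mem[OF that]]] by simp
  ultimately have "card {e \<in> edges (disjoint_union Gs). e \<subseteq> W} \<le> card (\<Union>i<length Gs. (`) (Pair i) ` ?E i)"
    by (intro card_mono) auto
  also have "\<dots> \<le> (\<Sum>i<length Gs. card ((`) (Pair i) ` ?E i))" by (rule card_UN_le) simp
  also have "\<dots> \<le> (\<Sum>i<length Gs. d * card (P i))"
  proof (rule sum_mono)
    fix i assume "i \<in> {..<length Gs}"
    then have i: "i < length Gs" by simp
    have "card ((`) (Pair i) ` ?E i) \<le> card (?E i)" using finE[OF i] by (rule card_image_le)
    also have "\<dots> \<le> d * card (P i)" using assms(2)[of "Gs ! i"] i P[OF i] unfolding sparse_def by simp
    finally show "card ((`) (Pair i) ` ?E i) \<le> d * card (P i)" .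
  qed
  also have "\<dots> = d * card W" using finP unfolding Weq by (simp add: sum_distrib_left)
  finally show "card {e \<in> edges (disjoint_union Gs). e \<subseteq> W} \<le> d * card W" .
qed

text \<open>The edges of the host inside \<open>W\<close> come from edges inside the preimage of \<open>W\<close>, which has at
  most \<open>k\<close> times as many vertices as \<open>W\<close>.\<close>

lemma sparse_if_folded_cover:
  assumes \<G>: "graph_class \<G>" "\<And>G. G \<in> \<G> \<Longrightarrow> sparse d G"
    and cov: "cover \<G> H Gs \<phi>" and fib: "fibres_le H Gs \<phi> k"
    and H: "fin_graph H"
  shows "sparse (d * k) H"
  unfolding sparse_def
proof (intro allI impI)
  fix W assume W: "W \<subseteq> verts H"
  let ?D = "disjoint_union Gs"
  have finG: "\<And>G. G \<in> set Gs \<Longrightarrow> fin_graph G" and spG: "\<And>G. G \<in> set Gs \<Longrightarrow> sparse d G"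
    using \<G> subsetD[of "set Gs" \<G>] cov by (simp_all add: cover_def graph_class_def)
  have D: "fin_graph ?D" using fin_graph_disjoint_union finG by blast
  define W' where "W' = {w \<in> verts ?D. \<phi> w \<in> W}"
  have finW: "finite W" using W finite_verts[OF H] finite_subset by blast
  have "{e \<in> edges H. e \<subseteq> W} \<subseteq> (`) \<phi> ` {e \<in> edges ?D. e \<subseteq> W'}"
  proof
    fix e assume e: "e \<in> {e \<in> edges H. e \<subseteq> W}"
    then have "\<exists>e'\<in>edges ?D. \<phi> ` e' = e" using cov by (simp add: cover_def)
    then obtain e' where e': "e' \<in> edges ?D" "\<phi> ` e' = e" by (elim bexE)
    then have "e' \<subseteq> W'" using D e unfolding W'_def fin_graph_def by auto
    then show "e \<in> (`) \<phi> ` {e \<in> edges ?D. e \<subseteq> W'}" using e' by blast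
  qed
  moreover have fin: "finite {e \<in> edges ?D. e \<subseteq> W'}" using finite_edges[OF D] by simp
  ultimately have "card {e \<in> edges H. e \<subseteq> W} \<le> card {e \<in> edges ?D. e \<subseteq> W'}"
    by (meson card_image_le card_mono finite_imageI order_trans)
  also have "\<dots> \<le> d * card W'"
    using sparse_disjoint_union[of Gs d] finG spG unfolding sparse_def W'_def by simp
  also have "card W' \<le> (\<Sum>v\<in>W. card {w \<in> verts ?D. \<phi> w = v})"
  proof -
    have "W' = (\<Union>v\<in>W. {w \<in> verts ?D. \<phi> w = v})" unfolding W'_def by auto
    then show ?thesis using card_UN_le[OF finW] by metis
  qed
  also have "\<dots> \<le> (\<Sum>v\<in>W. k)" using fib W unfolding fibres_le_def by (intro sum_mono) auto
  finally show "card {e \<in> edges H. e \<subseteq> W} \<le> d * k * card W" by (simp add: ac_simps)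
qed

text \<open>Otherwise the degrees inside \<open>W\<close> sum to more than \<open>2 * d * card W\<close>, while they sum to twice
  the number of edges inside \<open>W\<close>.\<close>

lemma sparse_low_degree_vertex:
  assumes H: "fin_graph H" and "sparse d H" and W: "W \<subseteq> verts H" "W \<noteq> {}"
  shows "\<exists>v\<in>W. card {u \<in> W. {u, v} \<in> edges H} \<le> 2 * d"
proof (rule ccontr)
  assume "\<not> ?thesis"
  then have big: "card {u \<in> W. {u, v} \<in> edges H} > 2 * d" if "v \<in> W" for v
    using that by (meson leI)
  let ?E = "{e \<in> edges H. e \<subseteq> W}"
  have finW: "finite W" using W finite_verts[OF H] finite_subset by blast
  have finE: "finite ?E" using finite_edges[OF H] by simp
  have deg: "card {u \<in> W. {u, v} \<in> edges H} \<le> card {e \<in> ?E. v \<in> e}" if "v \<in> W" for v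
  proof -
    have "inj_on (\<lambda>u. {u, v}) {u \<in> W. {u, v} \<in> edges H}"
      by (auto simp: inj_on_def doubleton_eq_iff)
    moreover have "(\<lambda>u. {u, v}) ` {u \<in> W. {u, v} \<in> edges H} \<subseteq> {e \<in> ?E. v \<in> e}" using that by auto
    moreover have "finite {e \<in> ?E. v \<in> e}" by (rule finite_subset[OF _ finE]) auto
    ultimately show ?thesis by (rule card_inj_on_le)
  qed
  have "(\<Sum>v\<in>W. card {e \<in> ?E. v \<in> e}) = 2 * card ?E"
  proof (rule sum_multicount[OF finW finE], rule ballI)
    fix e assume e: "e \<in> ?E"
    then have "{v \<in> W. v \<in> e} = e" by auto
    then show "card {v \<in> W. v \<in> e} = 2" using e H unfolding fin_graph_def by auto
  qed
  moreover have "(\<Sum>v\<in>W. 2 * d) < (\<Sum>v\<in>W. card {e \<in> ?E. v \<in> e})"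
    using finW W(2) big deg by (intro sum_strict_mono) (auto intro: less_le_trans)
  moreover have "card ?E \<le> d * card W" using assms(2) W(1) unfolding sparse_def by auto
  ultimately show False by (simp add: mult.commute mult.left_commute)
qed

text \<open>Vertices of low degree are added one at a time: the new vertex takes a colour that its
  earlier neighbours miss, and its edges to them are oriented away from it.\<close>

lemma degenerate_colouring_orientation:
  assumes H: "fin_graph H"
    and low: "\<And>W. W \<subseteq> verts H \<Longrightarrow> W \<noteq> {} \<Longrightarrow> \<exists>v\<in>W. card {u \<in> W. {u, v} \<in> edges H} \<le> D"
  obtains c :: "'a \<Rightarrow> nat" and T :: "('a \<times> 'a) set" where
    "\<And>v. c v \<le> D" "\<And>u v. {u, v} \<in> edges H \<Longrightarrow> c u \<noteq> c v"
    "\<And>u v. (u, v) \<in> T \<Longrightarrow> {u, v} \<in> edges H"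
    "\<And>u v. {u, v} \<in> edges H \<Longrightarrow> (u, v) \<in> T \<or> (v, u) \<in> T"
    "\<And>u. card (T `` {u}) \<le> D"
proof -
  have "\<exists>(c :: 'a \<Rightarrow> nat) T. (\<forall>v. c v \<le> D) \<and>
      (\<forall>u\<in>W. \<forall>v\<in>W. {u, v} \<in> edges H \<longrightarrow> c u \<noteq> c v) \<and>
      (\<forall>(u, v) \<in> T. u \<in> W \<and> v \<in> W \<and> {u, v} \<in> edges H) \<and>
      (\<forall>u\<in>W. \<forall>v\<in>W. {u, v} \<in> edges H \<longrightarrow> (u, v) \<in> T \<or> (v, u) \<in> T) \<and>
      (\<forall>u. card (T `` {u}) \<le> D)" if "W \<subseteq> verts H" for W
    using finite_subset[OF that finite_verts[OF H]] that
  proof (induction W rule: finite_psubset_induct)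
    case (psubset W)
    show ?case
    proof (cases "W = {}")
      case True
      then show ?thesis by (intro exI[of _ "\<lambda>_. 0"] exI[of _ "{}"]) simp
    next
      case False
      then obtain w where w: "w \<in> W" and deg: "card {u \<in> W. {u, w} \<in> edges H} \<le> D"
        using low psubset.prems by blast
      let ?N = "{u \<in> W. {u, w} \<in> edges H}"
      have wN: "w \<notin> ?N" using edge_verts(3)[OF H] by blast
      have finN: "finite ?N" using psubset.hyps by simp
      have sub: "W - {w} \<subset> W" "W - {w} \<subseteq> verts H" using w psubset.prems by auto
      obtain c :: "'a \<Rightarrow> nat" and T where cT: "\<forall>v. c v \<le> D"
        "\<forall>u\<in>W - {w}. \<forall>v\<in>W - {w}. {u, v} \<in> edges H \<longrightarrow> c u \<noteq> c v"
        "\<forall>(u, v) \<in> T. u \<in> W - {w} \<and> v \<in> W - {w} \<and> {u, v} \<in> edges H"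
        "\<forall>u\<in>W - {w}. \<forall>v\<in>W - {w}. {u, v} \<in> edges H \<longrightarrow> (u, v) \<in> T \<or> (v, u) \<in> T"
        "\<forall>u. card (T `` {u}) \<le> D"
        using psubset.IH[OF sub] by (elim exE conjE) (rule that)
      then have c: "\<And>v. c v \<le> D"
        "\<And>u v. u \<in> W - {w} \<Longrightarrow> v \<in> W - {w} \<Longrightarrow> {u, v} \<in> edges H \<Longrightarrow> c u \<noteq> c v"
        and T: "\<And>u v. (u, v) \<in> T \<Longrightarrow> u \<in> W - {w} \<and> v \<in> W - {w} \<and> {u, v} \<in> edges H"
        "\<And>u v. u \<in> W - {w} \<Longrightarrow> v \<in> W - {w} \<Longrightarrow> {u, v} \<in> edges H \<Longrightarrow> (u, v) \<in> T \<or> (v, u) \<in> T"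
        "\<And>u. card (T `` {u}) \<le> D"
        by (simp, simp, blast, simp, simp)
      have "card (c ` ?N) < card {..D}" using card_image_le[OF finN, of c] deg by simp
      then have "\<not> {..D} \<subseteq> c ` ?N" using finN by (meson card_mono finite_imageI leD)
      then obtain a where a: "a \<le> D" "a \<notin> c ` ?N" by auto
      define c' where "c' = c(w := a)"
      define T' where "T' = T \<union> {w} \<times> ?N"
      have nw: "{w, w} \<notin> edges H" using edge_verts(3)[OF H] by blast
      have "c' u \<noteq> c' v" if "u \<in> W" "v \<in> W" "{u, v} \<in> edges H" for u v
      proof -
        have uv: "u \<noteq> v" using edge_verts(3)[OF H that(3)] .
        have 0: "c x \<noteq> a" if "x \<in> W" "{x, w} \<in> edges H" for x using a(2) that by blast
        consider "u = w" | "v = w" | "u \<noteq> w" "v \<noteq> w" by blast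
        then show ?thesis
        proof cases
          case 1
          then show ?thesis using uv 0[of v] that unfolding c'_def by (auto simp: insert_commute)
        next
          case 2
          then show ?thesis using uv 0[of u] that unfolding c'_def by auto
        next
          case 3
          then show ?thesis using c(2)[of u v] that unfolding c'_def by auto
        qed
      qed
      moreover have "T' `` {u} = (if u = w then ?N else T `` {u})" for u
        using T(1) unfolding T'_def by auto
      then have "card (T' `` {u}) \<le> D" for u using T(3) deg by simp
      moreover have "(u, v) \<in> T' \<or> (v, u) \<in> T'" if "u \<in> W" "v \<in> W" "{u, v} \<in> edges H" for u v
      proof -
        have "{v, u} \<in> edges H" using that(3) by (simp add: insert_commute)
        then show ?thesis using T(2)[of u v] that unfolding T'_def by auto
      qed
      moreover have "\<forall>(u, v)\<in>T'. u \<in> W \<and> v \<in> W \<and> {u, v} \<in> edges H"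
        using T(1) w unfolding T'_def by (auto simp: insert_commute[of w])
      moreover have "\<forall>v. c' v \<le> D" using c(1) a(1) unfolding c'_def by simp
      ultimately show ?thesis by (intro exI[of _ c'] exI[of _ T']) simp
    qed
  qed
  from this[OF order_refl] obtain c :: "'a \<Rightarrow> nat" and T where
    "\<forall>v. c v \<le> D" "\<forall>u\<in>verts H. \<forall>v\<in>verts H. {u, v} \<in> edges H \<longrightarrow> c u \<noteq> c v"
    "\<forall>(u, v) \<in> T. u \<in> verts H \<and> v \<in> verts H \<and> {u, v} \<in> edges H"
    "\<forall>u\<in>verts H. \<forall>v\<in>verts H. {u, v} \<in> edges H \<longrightarrow> (u, v) \<in> T \<or> (v, u) \<in> T"
    "\<forall>u. card (T `` {u}) \<le> D" by (elim exE conjE) (rule that)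
  then show thesis using that[of c T] edge_verts[OF H] by blast
qed

section \<open>Stars\<close>

definition star :: "'a \<Rightarrow> 'a set \<Rightarrow> 'a graph" where
  "star v L = Graph (insert v L) ((\<lambda>u. {u, v}) ` L)"

lemma fin_graph_star: "finite L \<Longrightarrow> v \<notin> L \<Longrightarrow> fin_graph (star v L)"
  unfolding fin_graph_def star_def by (auto simp: card_insert_if)

lemma edge_star_iff:
  "{x, y} \<in> edges (star v L) \<longleftrightarrow> (x \<in> L \<and> y = v) \<or> (y \<in> L \<and> x = v)"
  unfolding star_def by (auto simp: doubleton_eq_iff image_iff)

lemma isomorphic_star:
  assumes "finite L" "finite L'" "card L = card L'" "v \<notin> L" "v' \<notin> L'"
  shows "isomorphic (star v L) (star v' L')"
proof -
  obtain h where h: "bij_betw h L L'" using finite_same_card_bij[OF assms(1-3)] by blast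
  define f where "f = h(v := v')"
  have f: "f v = v'" "\<And>x. x \<in> L \<Longrightarrow> f x = h x" "\<And>x. x \<in> L \<Longrightarrow> h x \<in> L'"
    "\<And>x. x \<in> L \<Longrightarrow> h x \<noteq> v'"
    using assms(5) assms(4) bij_betwE[OF h] unfolding f_def by auto
  have inj: "\<And>x y. x \<in> L \<Longrightarrow> y \<in> L \<Longrightarrow> h x = h y \<longleftrightarrow> x = y"
    using h by (auto simp: bij_betw_def inj_on_def)
  have bij: "bij_betw f (insert v L) (insert v' L')"
    using notIn_Un_bij_betw[of v L f L'] assms(4,5) f h bij_betw_cong[of L f h L'] by auto
  have "{x, y} \<in> edges (star v L) \<longleftrightarrow> {f x, f y} \<in> edges (star v' L')"
    if "x \<in> insert v L" "y \<in> insert v L" for x y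
    using that assms(4,5) f inj unfolding edge_star_iff by auto
  then have "graph_iso f (star v L) (star v' L')"
    using bij unfolding graph_iso_def by (simp add: star_def)
  then show ?thesis unfolding isomorphic_def by blast
qed

lemma star_in_class:
  assumes "graph_class \<G>" "star v L \<in> \<G>" "finite L" "finite L'" "card L = card L'" "v \<notin> L" "v' \<notin> L'"
  shows "star v' L' \<in> \<G>"
proof -
  have "isomorphic (star v L) (star v' L')" by (rule isomorphic_star) (use assms in auto)
  moreover have "fin_graph (star v' L')" using assms by (intro fin_graph_star)
  ultimately show ?thesis using assms(1,2) unfolding graph_class_def by blast
qed

lemma induced_star_in_class:
  assumes "graph_class \<G>" "hereditary \<G>" "G \<in> \<G>" "v \<in> verts G"
    and L: "\<And>u. u \<in> L \<Longrightarrow> {u, v} \<in> edges G"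
    and indep: "\<And>u u'. u \<in> L \<Longrightarrow> u' \<in> L \<Longrightarrow> {u, u'} \<notin> edges G"
  shows "star v L \<in> \<G>"
proof -
  have G: "fin_graph G" using assms(1,3) unfolding graph_class_def by blast
  have LG: "L \<subseteq> verts G" "v \<notin> L" using L edge_verts[OF G] by blast+
  have finL: "finite L" using LG(1) finite_verts[OF G] finite_subset by blast
  have "edges (star v L) = {e \<in> edges G. e \<subseteq> verts (star v L)}"
  proof (intro equalityI subsetI)
    fix e assume e: "e \<in> {e \<in> edges G. e \<subseteq> verts (star v L)}"
    then have "e \<in> edges G" by simp
    then obtain x y where xy: "e = {x, y}" "x \<noteq> y" "x \<in> verts G" "y \<in> verts G"
      by (rule edge_doubleton[OF G])
    then have "x \<in> insert v L" "y \<in> insert v L" "{x, y} \<in> edges G"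
      using e by (auto simp: star_def)
    then show "e \<in> edges (star v L)" using indep xy unfolding xy(1) edge_star_iff by auto
  qed (use L in \<open>auto simp: star_def\<close>)
  moreover have "subgraph (star v L) G"
    using fin_graph_star[OF finL LG(2)] G LG L assms(4) unfolding subgraph_def by (auto simp: star_def)
  ultimately have "induced_subgraph (star v L) G" unfolding induced_subgraph_def by (rule conjI[rotated])
  then show ?thesis using assms(2,3) unfolding hereditary_def by blast
qed

text \<open>A neighbour \<open>u\<close> of \<open>v\<close> is the image of a neighbour of one of the at most \<open>k\<close> points over \<open>v\<close>.
  The neighbours of such a point that are mapped to one colour are pairwise non-adjacent,
  because the cover map is a homomorphism. With the point they would induce a star, so there are
  fewer than \<open>card L0\<close> of them.\<close>

lemma degree_bound_without_star:
  assumes \<G>: "graph_class \<G>" "hereditary \<G>"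
    and no: "star v0 L0 \<notin> \<G>" "finite L0" "v0 \<notin> L0"
    and H: "fin_graph H" and cov: "cover \<G> H Gs \<phi>" and fib: "fibres_le H Gs \<phi> k"
    and c: "\<And>v. c v \<le> (D :: nat)" "\<And>u v. {u, v} \<in> edges H \<Longrightarrow> c u \<noteq> c v"
    and v: "v \<in> verts H"
  shows "card {u. {u, v} \<in> edges H} \<le> k * (D + 1) * card L0"
proof -
  let ?D = "disjoint_union Gs"
  have Gs: "set Gs \<subseteq> \<G>" using cov by (simp add: cover_def)
  have finG: "\<And>G. G \<in> set Gs \<Longrightarrow> fin_graph G" using Gs \<G> unfolding graph_class_def by blast
  have D: "fin_graph ?D" using fin_graph_disjoint_union finG by blast
  have hom: "{\<phi> (i, x), \<phi> (i, y)} \<in> edges H" if i: "i < length Gs" and xy: "{x, y} \<in> edges (Gs ! i)" for i x y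
  proof -
    have "guest_map \<phi> i ` {x, y} \<in> edges H"
      using cov i xy unfolding cover_iff graph_hom_def by blast
    then show ?thesis by (simp add: guest_map_def)
  qed
  define F where "F = {w \<in> verts ?D. \<phi> w = v}"
  have finF: "finite F" unfolding F_def using finite_verts[OF D] by simp
  define L where "L w a = {y. {y, snd w} \<in> edges (Gs ! fst w) \<and> c (\<phi> (fst w, y)) = a}" for w a
  have L: "finite (L w a)" "card (L w a) \<le> card L0" if w: "w \<in> F" for w a
  proof -
    obtain i x where ix: "w = (i, x)" "i < length Gs" "x \<in> verts (Gs ! i)"
      using w unfolding F_def verts_disjoint_union by auto
    have Gi: "Gs ! i \<in> \<G>" "fin_graph (Gs ! i)" using ix(2) Gs finG by auto
    have sub: "L w a \<subseteq> verts (Gs ! i)" using edge_verts[OF Gi(2)] ix(1) unfolding L_def by auto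
    then show fin: "finite (L w a)" using finite_verts[OF Gi(2)] finite_subset by blast
    show "card (L w a) \<le> card L0"
    proof (rule ccontr)
      assume "\<not> ?thesis"
      then obtain L' where L': "L' \<subseteq> L w a" "card L' = card L0" "finite L'"
        using obtain_subset_with_card_n[of "card L0" "L w a"] by auto
      have "star x L' \<in> \<G>"
      proof (rule induced_star_in_class[OF \<G> Gi(1) ix(3)])
        show "{u, x} \<in> edges (Gs ! i)" if "u \<in> L'" for u
          using that L'(1) ix(1) unfolding L_def by auto
        show "{u, u'} \<notin> edges (Gs ! i)" if u: "u \<in> L'" "u' \<in> L'" for u u'
        proof
          assume "{u, u'} \<in> edges (Gs ! i)"
          then have "c (\<phi> (i, u)) \<noteq> c (\<phi> (i, u'))" using c(2) hom[OF ix(2)] by blast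
          then show False using u L'(1) ix(1) unfolding L_def by auto
        qed
      qed
      moreover have "x \<notin> L'" using L'(1) ix(1) edge_verts(3)[OF Gi(2)] unfolding L_def by auto
      ultimately show False using no star_in_class[OF \<G>(1)] L' by metis
    qed
  qed
  have "{u. {u, v} \<in> edges H} \<subseteq> (\<Union>w\<in>F. \<Union>a\<le>D. (\<lambda>y. \<phi> (fst w, y)) ` L w a)"
  proof
    fix u assume "u \<in> {u. {u, v} \<in> edges H}"
    then have "\<exists>i<length Gs. \<exists>e'\<in>edges (Gs ! i). guest_map \<phi> i ` e' = {u, v}"
      using cov unfolding cover_iff by blast
    then obtain i e' where e': "i < length Gs" "e' \<in> edges (Gs ! i)" "guest_map \<phi> i ` e' = {u, v}"
      by (elim exE bexE conjE)
    have Gi: "fin_graph (Gs ! i)" using e'(1) finG by simp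
    obtain y x where xy: "e' = {y, x}" "\<phi> (i, y) = u" "\<phi> (i, x) = v"
      using edge_image_endpoints[OF Gi e'(2,3)] unfolding guest_map_def by blast
    have "x \<in> verts (Gs ! i)" using edge_verts(2)[OF Gi] e'(2) xy(1) by blast
    then have "(i, x) \<in> F" using xy e'(1) unfolding F_def verts_disjoint_union by auto
    moreover have "y \<in> L (i, x) (c u)" using xy e'(2) unfolding L_def by auto
    ultimately show "u \<in> (\<Union>w\<in>F. \<Union>a\<le>D. (\<lambda>y. \<phi> (fst w, y)) ` L w a)"
      using c(1)[of u] xy(2) by (intro UN_I[of "(i, x)"] UN_I[of "c u"] image_eqI[of _ _ y]) auto
  qed
  then have "card {u. {u, v} \<in> edges H} \<le> card (\<Union>w\<in>F. \<Union>a\<le>D. (\<lambda>y. \<phi> (fst w, y)) ` L w a)"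
    using finF L(1) by (intro card_mono) auto
  also have "\<dots> \<le> (\<Sum>w\<in>F. card (\<Union>a\<le>D. (\<lambda>y. \<phi> (fst w, y)) ` L w a))" by (rule card_UN_le[OF finF])
  also have "\<dots> \<le> (\<Sum>w\<in>F. \<Sum>a\<le>D. card ((\<lambda>y. \<phi> (fst w, y)) ` L w a))"
    by (intro sum_mono card_UN_le) simp
  also have "\<dots> \<le> (\<Sum>w\<in>F. \<Sum>a\<le>D. card L0)"
    using L by (intro sum_mono) (meson card_image_le order_trans)
  also have "\<dots> = card F * (D + 1) * card L0" by (simp add: algebra_simps)
  also have "\<dots> \<le> k * (D + 1) * card L0"
    using fib v unfolding fibres_le_def F_def by (intro mult_right_mono) auto
  finally show ?thesis .
qed

text \<open>Every pair of \<open>R\<close> leads from a leaf to its centre. Single-valuedness and the distinct colours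
  of leaves and centres make the stars vertex-disjoint. The leaves of one star share a colour, hence
  the star is induced in the host. Edges of the host between different stars do no harm, as
  only the components have to be induced.\<close>

lemma star_forest:
  fixes H :: "nat graph" and c :: "nat \<Rightarrow> 'c"
  assumes \<G>: "graph_class \<G>" and H: "fin_graph H"
    and R: "\<And>u v. (u, v) \<in> R \<Longrightarrow> {u, v} \<in> edges H \<and> c u = a \<and> c v = b" "single_valued R"
    and c: "\<And>u v. {u, v} \<in> edges H \<Longrightarrow> c u \<noteq> c v"
    and stars: "\<And>v. v \<in> Range R \<Longrightarrow> star v (R\<inverse> `` {v}) \<in> \<G>"
  defines "F \<equiv> Graph (Field R) {{u, v} | u v. (u, v) \<in> R}"
  shows "F \<in> disjoint_unions \<G>" and "weak_induced_subgraph F H"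
proof -
  \<comment> \<open>\<open>P x v\<close>: the vertex \<open>x\<close> lies in the star with centre \<open>v\<close>.\<close>
  define P where "P x v \<longleftrightarrow> v \<in> Range R \<and> (x = v \<or> (x, v) \<in> R)" for x v
  have P_unique: "v = v'" if "P x v" "P x v'" for x v v'
  proof -
    have "u \<noteq> v'" if "(u, v) \<in> R" "(x, v') \<in> R" "x = v" for u v v' x
      using R(1)[OF that(1)] R(1)[OF that(2)] c that(3) by metis
    then show ?thesis
      using that R(1) c R(2) unfolding P_def single_valued_def by (metis RangeE)
  qed
  have P_verts: "x \<in> verts (star v (R\<inverse> `` {v})) \<longleftrightarrow> P x v" if "v \<in> Range R" for x v
    using that unfolding P_def star_def by auto
  have P_field: "x \<in> verts F \<longleftrightarrow> (\<exists>v. P x v)" for x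
    unfolding F_def P_def Field_def by auto
  have F_edge: "{x, y} \<in> edges F \<longleftrightarrow> (x, y) \<in> R \<or> (y, x) \<in> R" for x y
    unfolding F_def by (auto simp: doubleton_eq_iff)
  have FH: "verts F \<subseteq> verts H" "edges F \<subseteq> edges H"
  proof -
    have "u \<in> verts H \<and> v \<in> verts H" if "(u, v) \<in> R" for u v
      using R(1)[OF that] edge_verts[OF H] by blast
    then show "verts F \<subseteq> verts H" unfolding F_def Field_def by auto
    show "edges F \<subseteq> edges H" using R(1) unfolding F_def by auto
  qed
  have finF: "fin_graph F"
  proof -
    have "e \<subseteq> verts F \<and> card e = 2" if "e \<in> edges F" for e
      using that FH(2) H unfolding fin_graph_def F_def Field_def by auto
    then show ?thesis
      using FH(1) finite_subset[OF FH(1) finite_verts[OF H]] unfolding fin_graph_def by blast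
  qed
  have finR: "finite (Range R)"
    using finite_subset[OF FH(1) finite_verts[OF H]] unfolding F_def Field_def by simp
  then obtain vs where vs: "set vs = Range R" "distinct vs" using finite_distinct_list[OF finR] by blast
  define Gs where "Gs = map (\<lambda>v. star v (R\<inverse> `` {v})) vs"
  have Gs: "set Gs \<subseteq> \<G>" "length Gs = length vs"
    "\<And>i. i < length vs \<Longrightarrow> Gs ! i = star (vs ! i) (R\<inverse> `` {vs ! i})"
    using stars vs unfolding Gs_def by auto
  have vsR: "\<And>i. i < length vs \<Longrightarrow> vs ! i \<in> Range R" using vs(1) nth_mem by blast
  have DU: "(i, x) \<in> verts (disjoint_union Gs) \<longleftrightarrow> i < length vs \<and> P x (vs ! i)" for i x
    using Gs P_verts vsR unfolding disjoint_union_def by auto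
  have "graph_iso snd (disjoint_union Gs) F"
    unfolding graph_iso_def
  proof (intro conjI ballI)
    have "inj_on snd (verts (disjoint_union Gs))"
    proof (rule inj_onI)
      fix p q assume pq: "p \<in> verts (disjoint_union Gs)" "q \<in> verts (disjoint_union Gs)" "snd p = snd q"
      obtain i x j where ij: "p = (i, x)" "q = (j, x)" using pq(3) by (cases p, cases q) auto
      then have i: "i < length vs" "P x (vs ! i)" "j < length vs" "P x (vs ! j)" using pq DU by auto
      then have "vs ! i = vs ! j" using P_unique by blast
      then show "p = q" using ij i vs(2) by (simp add: nth_eq_iff_index_eq)
    qed
    moreover have "snd ` verts (disjoint_union Gs) = verts F"
    proof (intro equalityI subsetI)
      fix x assume "x \<in> snd ` verts (disjoint_union Gs)"
      then show "x \<in> verts F" using DU P_field by auto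
    next
      fix x assume "x \<in> verts F"
      then obtain v where v: "P x v" using P_field by blast
      then have "v \<in> set vs" using vs unfolding P_def by simp
      then obtain i where "i < length vs" "vs ! i = v" by (metis in_set_conv_nth)
      then have "(i, x) \<in> verts (disjoint_union Gs)" using DU v by simp
      then show "x \<in> snd ` verts (disjoint_union Gs)" by force
    qed
    ultimately show "bij_betw snd (verts (disjoint_union Gs)) (verts F)" unfolding bij_betw_def by blast
  next
    fix p q assume pq: "p \<in> verts (disjoint_union Gs)" "q \<in> verts (disjoint_union Gs)"
    obtain i x j y where ix: "p = (i, x)" "q = (j, y)" by fastforce
    have i: "i < length vs" "P x (vs ! i)" "j < length vs" "P y (vs ! j)" using pq ix DU by auto
    have eq: "i = j" if "P x v" "P y v" for v
    proof -
      have "vs ! i = vs ! j" using P_unique[OF i(2) that(1)] P_unique[OF i(4) that(2)] by simp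
      then show ?thesis using i vs(2) by (simp add: nth_eq_iff_index_eq)
    qed
    have "{p, q} \<in> edges (disjoint_union Gs) \<longleftrightarrow> i = j \<and>
        ((x, vs ! i) \<in> R \<and> y = vs ! i \<or> (y, vs ! i) \<in> R \<and> x = vs ! i)"
      using ix i Gs by (auto simp: edge_disjoint_union_iff edge_star_iff)
    also have "\<dots> \<longleftrightarrow> (x, y) \<in> R \<or> (y, x) \<in> R"
    proof
      assume "(x, y) \<in> R \<or> (y, x) \<in> R"
      then show "i = j \<and> ((x, vs ! i) \<in> R \<and> y = vs ! i \<or> (y, vs ! i) \<in> R \<and> x = vs ! i)"
      proof
        assume a: "(x, y) \<in> R"
        then have "P x y" "P y y" unfolding P_def by auto
        then show ?thesis using a eq P_unique i by blast
      next
        assume a: "(y, x) \<in> R"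
        then have "P x x" "P y x" unfolding P_def by auto
        then show ?thesis using a eq P_unique i by blast
      qed
    qed auto
    finally show "{p, q} \<in> edges (disjoint_union Gs) \<longleftrightarrow> {snd p, snd q} \<in> edges F"
      using ix F_edge by simp
  qed
  then show "F \<in> disjoint_unions \<G>"
    using finF Gs(1) unfolding disjoint_unions_def isomorphic_def by blast
  have step: "P y v" if "P x v" "(x, y) \<in> adj F" for x y v
  proof -
    have "(x, y) \<in> R \<or> (y, x) \<in> R" using that F_edge unfolding adj_def by simp
    then have "P x y \<and> P y y \<or> P x x \<and> P y x" unfolding P_def by auto
    then show ?thesis using P_unique that by blast
  qed
  have reach: "P y v" if "(x, y) \<in> (adj F)\<^sup>*" "P x v" for x y v
    using that by (induction rule: rtrancl_induct) (auto intro: step)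
  have "{x, y} \<in> edges F" if x: "x \<in> verts F" "(x, y) \<in> (adj F)\<^sup>*" "{x, y} \<in> edges H" for x y
  proof -
    obtain v where v: "P x v" using x P_field by blast
    then have "P y v" using reach x(2) by blast
    moreover have "\<not> ((x, v) \<in> R \<and> (y, v) \<in> R)" using R(1) c x(3) by metis
    moreover have "x \<noteq> y" using edge_verts(3)[OF H x(3)] .
    ultimately show ?thesis using v F_edge unfolding P_def by auto
  qed
  then show "weak_induced_subgraph F H"
    unfolding weak_induced_iff subgraph_def using finF H FH by blast
qed

section \<open>Covers of sparse hosts by induced star forests\<close>

text \<open>An edge oriented from \<open>u\<close> to \<open>v\<close> is classified by its number among the edges leaving \<open>u\<close>,
  by its slot among the edges entering \<open>v\<close>, and by the colours of \<open>u\<close> and \<open>v\<close>. The first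
  coordinate leaves at most one edge of the class at \<open>u\<close>, and the colours prevent \<open>v\<close> from being
  a leaf as well, so a class is a star forest with induced stars. The slot controls the size of
  these stars: a constant slot keeps all edges of a class at \<open>v\<close> together, an injective one
  makes the class a matching.\<close>

lemma ic_union_le_by_star_forests:
  fixes H :: "nat graph"
  assumes \<G>: "graph_class \<G>" and H: "fin_graph H"
    and c: "\<And>v. c v \<le> D" "\<And>u v. {u, v} \<in> edges H \<Longrightarrow> c u \<noteq> c v"
    and T: "\<And>u v. (u, v) \<in> T \<Longrightarrow> {u, v} \<in> edges H"
      "\<And>u v. {u, v} \<in> edges H \<Longrightarrow> (u, v) \<in> T \<or> (v, u) \<in> T"
      "\<And>u. card (T `` {u}) \<le> D"
    and slot: "\<And>u v. (u, v) \<in> T \<Longrightarrow> slot u v < (M :: nat)"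
    and stars: "\<And>v L s. L \<noteq> {} \<Longrightarrow> (\<And>u. u \<in> L \<Longrightarrow> (u, v) \<in> T \<and> slot u v = s) \<Longrightarrow> star v L \<in> \<G>"
  shows "ic_union \<G> H \<le> enat (D * M * (D + 1) * (D + 1))"
proof -
  have finT: "finite (T `` {u})" for u
    using edge_verts(2)[OF H T(1)] finite_subset[OF _ finite_verts[OF H], of "T `` {u}"] by blast
  have "\<exists>j. inj_on j (T `` {u}) \<and> j ` (T `` {u}) \<subseteq> {..<D}" for u
  proof -
    obtain j where "bij_betw j (T `` {u}) {0..<card (T `` {u})}"
      using ex_bij_betw_finite_nat[OF finT] by blast
    then show ?thesis using T(3)[of u] unfolding bij_betw_def by (intro exI[of _ j]) auto
  qed
  then obtain j where j: "\<And>u. inj_on (j u) (T `` {u})" "\<And>u. j u ` (T `` {u}) \<subseteq> {..<D}"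
    by metis
  define R where "R = (\<lambda>(p, s, a, b). {(u, v) \<in> T. j u v = p \<and> slot u v = s \<and> c u = a \<and> c v = b})"
  define K where "K i = Graph (Field (R i)) {{u, v} | u v. (u, v) \<in> R i}" for i
  define I where "I = {..<D} \<times> {..<M} \<times> {..D} \<times> {..D}"
  have K: "K i \<in> disjoint_unions \<G>" "weak_induced_subgraph (K i) H" for i
  proof -
    obtain p s a b where i: "i = (p, s, a, b)" using prod_cases4 by blast
    have R: "{u, v} \<in> edges H \<and> c u = a \<and> c v = b" if "(u, v) \<in> R i" for u v
      using that T(1) unfolding R_def i by auto
    have sv: "single_valued (R i)"
    proof (rule single_valuedI)
      fix u v w assume "(u, v) \<in> R i" "(u, w) \<in> R i"
      then show "v = w" using inj_onD[OF j(1)[of u]] unfolding R_def i by auto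
    qed
    have st: "star v ((R i)\<inverse> `` {v}) \<in> \<G>" if "v \<in> Range (R i)" for v
    proof (rule stars[where s = s])
      show "(R i)\<inverse> `` {v} \<noteq> {}" using that by auto
    qed (auto simp: R_def i)
    show "K i \<in> disjoint_unions \<G>" "weak_induced_subgraph (K i) H"
      unfolding K_def using star_forest[OF \<G> H R sv c(2) st] by blast+
  qed
  have "edges H \<subseteq> (\<Union>i\<in>I. edges (K i))"
  proof
    fix e assume e: "e \<in> edges H"
    then obtain x y where xy: "e = {x, y}" "x \<noteq> y" "x \<in> verts H" "y \<in> verts H"
      by (rule edge_doubleton[OF H])
    then obtain u v where uv: "e = {u, v}" "(u, v) \<in> T" using T(2)[of x y] e by (metis insert_commute)
    define i where "i = (j u v, slot u v, c u, c v)"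
    have "j u v < D" using j(2)[of u] uv(2) by auto
    then have "i \<in> I" using slot[OF uv(2)] c(1) unfolding I_def i_def by simp
    moreover have "e \<in> edges (K i)" using uv unfolding K_def R_def i_def by auto
    ultimately show "e \<in> (\<Union>i\<in>I. edges (K i))" by blast
  qed
  moreover have "subgraph (K i) H" for i using K(2) unfolding weak_induced_iff by blast
  ultimately have "ic_union \<G> H \<le> enat (card I)"
    using K by (intro subgraph_family_cover(2)) (auto simp: I_def)
  also have "card I = D * M * (D + 1) * (D + 1)" unfolding I_def
    by (simp only: card_cartesian_product card_lessThan card_atMost Suc_eq_plus1 mult.assoc)
  finally show ?thesis .
qed

lemma edge_in_class_if_cover:
  assumes \<G>: "graph_class \<G>" "hereditary \<G>" and H: "fin_graph H"
    and cov: "cover \<G> H Gs \<phi>" and e: "e \<in> edges H" and uv: "u \<noteq> v"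
  shows "star v {u} \<in> \<G>"
proof -
  have "\<exists>i<length Gs. \<exists>e'\<in>edges (Gs ! i). guest_map \<phi> i ` e' = e"
    using cov e by (simp add: cover_iff)
  then obtain i e' where i: "i < length Gs" "e' \<in> edges (Gs ! i)" by auto
  then have G: "Gs ! i \<in> \<G>" "fin_graph (Gs ! i)"
    using subsetD[of "set Gs" \<G>, OF _ nth_mem[OF i(1)]] cov \<G>(1)
    unfolding graph_class_def cover_def by simp_all
  obtain x y where xy: "e' = {x, y}" "x \<noteq> y" "x \<in> verts (Gs ! i)" "y \<in> verts (Gs ! i)"
    using i(2) by (rule edge_doubleton[OF G(2)])
  have "star y {x} \<in> \<G>"
  proof (rule induced_star_in_class[OF \<G> G(1) xy(4)])
    show "{a, a'} \<notin> edges (Gs ! i)" if "a \<in> {x}" "a' \<in> {x}" for a a'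
      using that edge_verts(3)[OF G(2)] by blast
  qed (use i xy in auto)
  then show ?thesis by (rule star_in_class[OF \<G>(1)]) (use xy uv in auto)
qed

text \<open>Slots are constant if all stars are available as guests. If a star is missing, then the
  degrees are bounded and the slots can number the edges that enter a vertex.\<close>

theorem ic_union_bounded_on_sparse_hosts:
  assumes \<G>: "graph_class \<G>" "hereditary \<G>"
  obtains g :: "nat \<Rightarrow> nat \<Rightarrow> nat" where
    "\<And>(H :: nat graph) d k. fin_graph H \<Longrightarrow> sparse d H \<Longrightarrow> c_folded \<G> H \<le> enat k \<Longrightarrow>
       ic_union \<G> H \<le> enat (g d k)"
proof (cases "\<forall>v L. finite L \<and> v \<notin> L \<longrightarrow> star v L \<in> \<G>")
  case True
  have "ic_union \<G> H \<le> enat ((2 * d) * 1 * (2 * d + 1) * (2 * d + 1))"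
    if H: "fin_graph H" "sparse d H" for H :: "nat graph" and d
  proof -
    obtain c T where c: "\<And>v. c v \<le> 2 * d" "\<And>u v. {u, v} \<in> edges H \<Longrightarrow> c u \<noteq> c v"
      and T: "\<And>u v. (u, v) \<in> T \<Longrightarrow> {u, v} \<in> edges H"
        "\<And>u v. {u, v} \<in> edges H \<Longrightarrow> (u, v) \<in> T \<or> (v, u) \<in> T" "\<And>u. card (T `` {u}) \<le> 2 * d"
      using degenerate_colouring_orientation[OF H(1) sparse_low_degree_vertex[OF H]] by metis
    have "star v L \<in> \<G>" if L: "\<And>u. u \<in> L \<Longrightarrow> (u, v) \<in> T \<and> 0 = s" for v L and s :: nat
    proof -
      have "L \<subseteq> verts H - {v}" using L T(1) edge_verts[OF H(1)] by blast
      then show ?thesis using True finite_verts[OF H(1)] finite_subset[of L "verts H"] by blast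
    qed
    then show ?thesis
      by (intro ic_union_le_by_star_forests[OF \<G>(1) H(1) c T, where slot = "\<lambda>u v. 0"]) auto
  qed
  then show ?thesis using that[of "\<lambda>d k. (2 * d) * 1 * (2 * d + 1) * (2 * d + 1)"] by blast
next
  case False
  then obtain v0 L0 where no: "star v0 L0 \<notin> \<G>" "finite L0" "v0 \<notin> L0" by blast
  let ?M = "\<lambda>d k. k * (2 * d + 1) * card L0"
  have "ic_union \<G> H \<le> enat ((2 * d) * ?M d k * (2 * d + 1) * (2 * d + 1))"
    if H: "fin_graph H" "sparse d H" and k: "c_folded \<G> H \<le> enat k" for H :: "nat graph" and d k
  proof -
    obtain c T where c: "\<And>v. c v \<le> 2 * d" "\<And>u v. {u, v} \<in> edges H \<Longrightarrow> c u \<noteq> c v"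
      and T: "\<And>u v. (u, v) \<in> T \<Longrightarrow> {u, v} \<in> edges H"
        "\<And>u v. {u, v} \<in> edges H \<Longrightarrow> (u, v) \<in> T \<or> (v, u) \<in> T" "\<And>u. card (T `` {u}) \<le> 2 * d"
      using degenerate_colouring_orientation[OF H(1) sparse_low_degree_vertex[OF H]] by metis
    obtain Gs \<phi> where cov: "cover \<G> H Gs \<phi>" "fibres_le H Gs \<phi> k" using c_folded_cover[OF k] .
    define N where "N v = {u. {u, v} \<in> edges H}" for v
    have finN: "finite (N v)" for v
      using edge_verts(1)[OF H(1)] finite_subset[OF _ finite_verts[OF H(1)], of "N v"]
      unfolding N_def by blast
    have "\<exists>s. inj_on s (N v) \<and> s ` N v \<subseteq> {..<?M d k}" for v
    proof (cases "v \<in> verts H")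
      case True
      have "card (N v) \<le> ?M d k"
        unfolding N_def by (rule degree_bound_without_star[OF \<G> no H(1) cov c True])
      moreover obtain s where "bij_betw s (N v) {0..<card (N v)}"
        using ex_bij_betw_finite_nat[OF finN] by blast
      ultimately show ?thesis unfolding bij_betw_def by (intro exI[of _ s]) auto
    next
      case False
      then have "N v = {}" using edge_verts(2)[OF H(1)] unfolding N_def by blast
      then show ?thesis by simp
    qed
    then obtain s where s: "\<And>v. inj_on (s v) (N v)" "\<And>v. s v ` N v \<subseteq> {..<?M d k}" by metis
    have TN: "u \<in> N v" if "(u, v) \<in> T" for u v using T(1)[OF that] unfolding N_def by simp
    \<comment> \<open>The slots at \<open>v\<close> are distinct, so the star has one leaf only.\<close>
    have stars: "star v L \<in> \<G>" if L: "L \<noteq> {}" "\<And>u. u \<in> L \<Longrightarrow> (u, v) \<in> T \<and> s v u = t" for v L t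
    proof -
      obtain u where u: "u \<in> L" using L(1) by blast
      have "L = {u}" using u L(2) TN inj_onD[OF s(1)[of v]] by blast
      moreover have "{u, v} \<in> edges H" using u L(2) T(1) by blast
      ultimately show ?thesis
        using edge_in_class_if_cover[OF \<G> H(1) cov(1)] edge_verts(3)[OF H(1)] by metis
    qed
    have slot: "s v u < ?M d k" if "(u, v) \<in> T" for u v using s(2)[of v] TN[OF that] by auto
    show ?thesis
      by (rule ic_union_le_by_star_forests[where c = c and T = T and slot = "\<lambda>u v. s v u"];
          fact \<G>(1) H(1) c T slot stars)
  qed
  then show ?thesis using that[of "\<lambda>d k. (2 * d) * ?M d k * (2 * d + 1) * (2 * d + 1)"] by blast
qed

lemma ic_c_bounded_if_mad_bounded:
  assumes \<G>: "graph_class \<G>" "hereditary \<G>" and \<H>: "graph_class \<H>"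
    and mad: "bdd_above (mad ` \<G>) \<or> bdd_above (mad ` \<H>)"
  shows "ic_c_bounded x \<G> \<H>"
proof -
  obtain g where g: "\<And>(H :: nat graph) d k. fin_graph H \<Longrightarrow> sparse d H \<Longrightarrow> c_folded \<G> H \<le> enat k \<Longrightarrow>
       ic_union \<G> H \<le> enat (g d k)"
    using ic_union_bounded_on_sparse_hosts[OF \<G>] by metis
  have bound: "\<exists>d. \<forall>G\<in>\<C>. sparse d G" if C: "bdd_above (mad ` \<C>)" "graph_class \<C>" for \<C> :: "nat graph set"
  proof -
    obtain r where "\<And>G. G \<in> \<C> \<Longrightarrow> mad G \<le> r" using C(1) unfolding bdd_above_def by auto
    moreover obtain d :: nat where "r \<le> real d" using real_arch_simple by blast
    ultimately have "mad G \<le> real d" if "G \<in> \<C>" for G using that by (meson order_trans)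
    then show ?thesis using C(2) mad_le_imp_sparse unfolding graph_class_def by blast
  qed
  have "\<exists>d :: nat \<Rightarrow> nat. \<forall>H\<in>\<H>. \<forall>k. c_folded \<G> H \<le> enat k \<longrightarrow> sparse (d k) H"
    using mad
  proof
    assume "bdd_above (mad ` \<G>)"
    then obtain d where d: "\<And>G. G \<in> \<G> \<Longrightarrow> sparse d G" using bound \<G>(1) by blast
    have "sparse (d * k) H" if H: "H \<in> \<H>" "c_folded \<G> H \<le> enat k" for H k
    proof -
      obtain Gs \<phi> where "cover \<G> H Gs \<phi>" "fibres_le H Gs \<phi> k" using c_folded_cover[OF H(2)] .
      then show ?thesis using sparse_if_folded_cover[OF \<G>(1) d] H(1) \<H> unfolding graph_class_def by blast
    qed
    then show ?thesis by blast
  next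
    assume "bdd_above (mad ` \<H>)"
    then obtain d where "\<forall>H\<in>\<H>. sparse d H" using bound \<H> by blast
    then show ?thesis by (intro exI[of _ "\<lambda>_. d"]) simp
  qed
  then obtain d :: "nat \<Rightarrow> nat" where d: "\<And>H k. H \<in> \<H> \<Longrightarrow> c_folded \<G> H \<le> enat k \<Longrightarrow> sparse (d k) H"
    by blast
  have "ic_num x \<G> H \<le> enat (g (d k) k)" if H: "H \<in> \<H>" "c_num x \<G> H = enat k" for H k
  proof -
    have "c_folded \<G> H \<le> enat k" using covering_numbers_between(1)[OF \<G>(1), of H x] H(2) by simp
    moreover have "fin_graph H" using H(1) \<H> unfolding graph_class_def by blast
    ultimately have "ic_union \<G> H \<le> enat (g (d k) k)" using g d H(1) by blast
    then show ?thesis using covering_numbers_between(4)[OF \<G>(1), of x H] by (rule order_trans[rotated])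
  qed
  then show ?thesis unfolding ic_c_bounded_def by (intro exI[of _ "\<lambda>k. g (d k) k"]) blast
qed

section \<open>Complete and complete bipartite guests\<close>

definition complete_graph :: "'a graph \<Rightarrow> bool" where
  "complete_graph G \<longleftrightarrow> (\<forall>u\<in>verts G. \<forall>v\<in>verts G. {u, v} \<in> edges G \<longleftrightarrow> u \<noteq> v)"

text \<open>One of the two sides may be empty, so edgeless graphs are included. This makes the class
  closed under induced subgraphs.\<close>

definition complete_bipartite :: "'a graph \<Rightarrow> bool" where
  "complete_bipartite G \<longleftrightarrow>
     (\<exists>s :: 'a \<Rightarrow> bool. \<forall>u\<in>verts G. \<forall>v\<in>verts G. {u, v} \<in> edges G \<longleftrightarrow> s u \<noteq> s v)"

definition complete_or_bipartite :: "nat graph set" where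
  "complete_or_bipartite = {G. fin_graph G \<and> (complete_graph G \<or> complete_bipartite G)}"

lemma graph_class_complete_or_bipartite: "graph_class complete_or_bipartite"
  unfolding graph_class_def
proof (intro conjI ballI allI impI)
  fix G G' :: "nat graph"
  assume G: "G \<in> complete_or_bipartite" and "fin_graph G' \<and> isomorphic G G'"
  then obtain f where G': "fin_graph G'" and "graph_iso f G G'" unfolding isomorphic_def by blast
  define h where "h = inv_into (verts G) f"
  have h: "graph_iso h G' G" using graph_iso_inv[OF \<open>graph_iso f G G'\<close>] unfolding h_def .
  then have hv: "\<And>x. x \<in> verts G' \<Longrightarrow> h x \<in> verts G" "inj_on h (verts G')"
    and he: "\<And>x y. x \<in> verts G' \<Longrightarrow> y \<in> verts G' \<Longrightarrow> {x, y} \<in> edges G' \<longleftrightarrow> {h x, h y} \<in> edges G"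
    unfolding graph_iso_def bij_betw_def by auto
  have "complete_graph G' \<or> complete_bipartite G'"
  proof (cases "complete_graph G")
    case True
    then have "complete_graph G'"
      using hv he unfolding complete_graph_def by (simp add: inj_on_eq_iff)
    then show ?thesis by simp
  next
    case False
    then obtain s where "\<forall>u\<in>verts G. \<forall>v\<in>verts G. {u, v} \<in> edges G \<longleftrightarrow> (s u :: bool) \<noteq> s v"
      using G unfolding complete_or_bipartite_def complete_bipartite_def by blast
    then have "complete_bipartite G'"
      using hv he unfolding complete_bipartite_def by (intro exI[of _ "s \<circ> h"]) simp
    then show ?thesis by simp
  qed
  then show "G' \<in> complete_or_bipartite" using G' unfolding complete_or_bipartite_def by simp
qed (simp add: complete_or_bipartite_def)

lemma hereditary_complete_or_bipartite: "hereditary complete_or_bipartite"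
  unfolding hereditary_def
proof (intro ballI allI impI)
  fix G K :: "nat graph"
  assume G: "G \<in> complete_or_bipartite" and K: "induced_subgraph K G"
  have KG: "fin_graph K" "verts K \<subseteq> verts G"
    and e: "\<And>u v. u \<in> verts K \<Longrightarrow> v \<in> verts K \<Longrightarrow> {u, v} \<in> edges K \<longleftrightarrow> {u, v} \<in> edges G"
    using K unfolding induced_subgraph_def subgraph_def by auto
  have "complete_graph G \<Longrightarrow> complete_graph K"
    unfolding complete_graph_def using KG(2) e by (simp add: subset_iff)
  moreover have "complete_bipartite K" if "complete_bipartite G"
  proof -
    from that obtain s where "\<forall>u\<in>verts G. \<forall>v\<in>verts G. {u, v} \<in> edges G \<longleftrightarrow> (s u :: bool) \<noteq> s v"
      unfolding complete_bipartite_def by (elim exE)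
    then show ?thesis
      unfolding complete_bipartite_def using KG(2) e by (intro exI[of _ s]) (simp add: subset_iff)
  qed
  ultimately show "K \<in> complete_or_bipartite"
    using G KG(1) unfolding complete_or_bipartite_def by blast
qed

text \<open>The vertices below \<open>n\<close> form a clique, the other \<open>n\<close> vertices are independent, and all edges
  between the two parts are present.\<close>

definition complete_split :: "nat \<Rightarrow> nat graph" where
  "complete_split n = Graph {..<2 * n} 
    {{u, v} | u v. u \<noteq> v \<and> u < 2 * n \<and> v < 2 * n \<and> (u < n \<or> v < n)}"

lemma doubleton_mem_iff:
  assumes "\<And>u v. P u v \<Longrightarrow> P v u"
  shows "{x, y} \<in> {{u, v} | u v. P u v} \<longleftrightarrow> P x y"
  using assms by (auto simp: doubleton_eq_iff)

lemma complete_split_edge: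
  "{u, v} \<in> edges (complete_split n) \<longleftrightarrow> u \<noteq> v \<and> u < 2 * n \<and> v < 2 * n \<and> (u < n \<or> v < n)"
  unfolding complete_split_def graph.sel by (rule doubleton_mem_iff) auto

lemma fin_graph_complete_split: "fin_graph (complete_split n)"
  unfolding fin_graph_def complete_split_def by auto

lemma c_union_complete_split: "c_union complete_or_bipartite (complete_split n) \<le> enat 2"
proof -
  define K where "K i = (if i then Graph {..<n} {{u, v} | u v. u \<noteq> v \<and> u < n \<and> v < n}
      else Graph {..<2 * n} {{u, v} | u v. u < 2 * n \<and> v < 2 * n \<and> (u < n) \<noteq> (v < n)})" for i
  have ke: "{u, v} \<in> edges (K True) \<longleftrightarrow> u \<noteq> v \<and> u < n \<and> v < n"
    "{u, v} \<in> edges (K False) \<longleftrightarrow> u < 2 * n \<and> v < 2 * n \<and> (u < n) \<noteq> (v < n)" for u v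
    unfolding K_def if_True if_False graph.sel by (rule doubleton_mem_iff; auto)+
  have fin: "fin_graph (K i)" for i unfolding fin_graph_def K_def by (auto simp: card_insert_if)
  have "complete_graph (K True)" unfolding complete_graph_def ke by (simp add: K_def)
  moreover have "complete_bipartite (K False)"
    unfolding complete_bipartite_def ke by (intro exI[of _ "\<lambda>u. u < n"]) (simp add: K_def)
  ultimately have "K i \<in> complete_or_bipartite" for i
    using fin unfolding complete_or_bipartite_def by (cases i) auto
  then have KU: "K i \<in> disjoint_unions complete_or_bipartite" for i
    using fin by (rule in_disjoint_unions)
  have "c_union complete_or_bipartite (complete_split n) \<le> enat (card (UNIV :: bool set))"
  proof (rule subgraph_family_cover(1)[where K = K])
    show "subgraph (K i) (complete_split n)" for i
    proof -
      have "e \<in> edges (complete_split n)" if e: "e \<in> edges (K i)" for e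
      proof -
        obtain u v where "e = {u, v}" "u \<noteq> v" "u \<in> verts (K i)" "v \<in> verts (K i)"
          using e by (rule edge_doubleton[OF fin])
        then show ?thesis using e ke by (cases i) (auto simp: complete_split_edge)
      qed
      moreover have "verts (K i) \<subseteq> verts (complete_split n)" by (auto simp: K_def complete_split_def)
      ultimately show ?thesis
        using fin[of i] fin_graph_complete_split[of n] unfolding subgraph_def by blast
    qed
    show "edges (complete_split n) \<subseteq> (\<Union>i\<in>UNIV. edges (K i))"
    proof
      fix e assume e: "e \<in> edges (complete_split n)"
      obtain u v where "e = {u, v}" "u \<noteq> v" "u \<in> verts (complete_split n)" "v \<in> verts (complete_split n)"
        using e by (rule edge_doubleton[OF fin_graph_complete_split])
      then have "e \<in> edges (K (u < n \<and> v < n))"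
        using e ke by (cases "u < n \<and> v < n") (auto simp: complete_split_edge)
      then show "e \<in> (\<Union>i\<in>UNIV. edges (K i))" by blast
    qed
  qed (use KU in auto)
  then show ?thesis by simp
qed

text \<open>Suppose that the path \<open>z', w, z, w'\<close> of the guest had four different images. In a complete
  guest \<open>z\<close> and \<open>z'\<close> are adjacent, but their images are not. In a complete bipartite guest
  \<open>w\<close> and \<open>w'\<close> lie on the same side. A vertex with the same image as \<open>w\<close> cannot be adjacent
  to \<open>w\<close> and so lies on the same side as \<open>w\<close>, and similarly for \<open>w'\<close>. Therefore no edge of the
  guest covers the edge between the images of \<open>w\<close> and \<open>w'\<close>, which belongs to the image if
  that is weak induced.\<close>

lemma weak_induced_guest_in_complete_split:
  assumes G: "G \<in> complete_or_bipartite" and hom: "graph_hom f G (complete_split n)"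
    and wi: "weak_induced_subgraph (graph_image f G) (complete_split n)"
    and w: "{w, z} \<in> edges G" "f w < n" "n \<le> f z"
    and z': "{w, z'} \<in> edges G" "n \<le> f z'" and w': "{w', z} \<in> edges G" "f w' < n"
  shows "f z' = f z \<or> f w' = f w"
proof (rule ccontr)
  assume ne: "\<not> ?thesis"
  let ?H = "complete_split n" and ?K = "graph_image f G"
  have fG: "fin_graph G" using G unfolding complete_or_bipartite_def by simp
  have fe: "{f x, f y} \<in> edges ?H \<and> {f x, f y} \<in> edges ?K" if "{x, y} \<in> edges G" for x y
  proof -
    have "f ` {x, y} \<in> edges ?H" using hom that unfolding graph_hom_def by blast
    moreover have "f ` {x, y} \<in> edges ?K"
      using imageI[OF that, of "(`) f"] unfolding graph_image_def by simp
    ultimately show ?thesis by simp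
  qed
  have v: "w \<in> verts G" "z \<in> verts G" "z' \<in> verts G" "w' \<in> verts G"
    using edge_verts[OF fG] w(1) z'(1) w'(1) by blast+
  have "f w < 2 * n" "f w' < 2 * n"
    using fe[OF w(1)] fe[OF w'(1)] by (auto simp: complete_split_edge)
  then have "{f w, f w'} \<in> edges ?H" using ne w w' by (auto simp: complete_split_edge)
  moreover have "(f w, f z) \<in> adj ?K" "(f z, f w') \<in> adj ?K"
    using fe[OF w(1)] fe[OF w'(1)] unfolding adj_def by (auto simp: insert_commute)
  then have "(f w, f w') \<in> (adj ?K)\<^sup>*" by (meson r_into_rtrancl rtrancl_trans)
  ultimately have "{f w, f w'} \<in> edges ?K"
    using wi v(1) unfolding weak_induced_iff by (auto simp: graph_image_def)
  then have "\<exists>e\<in>edges G. f ` e = {f w, f w'}" unfolding graph_image_def by auto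
  then obtain e where e: "e \<in> edges G" "f ` e = {f w, f w'}" by (elim bexE)
  then obtain p q where pq: "{p, q} \<in> edges G" "f p = f w" "f q = f w'"
    using edge_image_endpoints[OF fG e] by metis
  have pqv: "p \<in> verts G" "q \<in> verts G" using edge_verts[OF fG pq(1)] by blast+
  have noedge: "{x, y} \<notin> edges G" if "f x = f y" for x y
    using fe[of x y] that complete_split_edge[of "f y" "f y" n] by auto
  have "complete_graph G \<or> complete_bipartite G" using G unfolding complete_or_bipartite_def by simp
  then show False
  proof
    assume "complete_graph G"
    then have "{z, z'} \<in> edges G" using ne v unfolding complete_graph_def by auto
    then show False using fe[of z z'] w(3) z'(2) by (auto simp: complete_split_edge)
  next
    assume "complete_bipartite G"
    then obtain s where s: "\<And>x y. x \<in> verts G \<Longrightarrow> y \<in> verts G \<Longrightarrow> {x, y} \<in> edges G \<longleftrightarrow> (s x :: bool) \<noteq> s y"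
      unfolding complete_bipartite_def by blast
    have "s w' = s w" using s v w(1) w'(1) by metis
    moreover have "s p = s w" using s[of p w] noedge[of p w] pq v pqv by auto
    moreover have "s q = s w'" using s[of q w'] noedge[of q w'] pq v pqv by auto
    ultimately show False using s[of p q] pq pqv by auto
  qed
qed

text \<open>Each edge of the host between a clique vertex \<open>a\<close> and an independent vertex \<open>b\<close> is charged
  to a point over one of its ends: to a point over \<open>a\<close> all of whose independent neighbours are
  mapped to \<open>b\<close>, or to a point over \<open>b\<close> all of whose clique neighbours are mapped to \<open>a\<close>. The
  previous lemma provides such a point, and each point is charged at most once. So the
  \<open>n * n\<close> edges are bounded by the \<open>2 * n * l\<close> points.\<close>

lemma ic_folded_complete_split: "enat n \<le> 2 * ic_folded complete_or_bipartite (complete_split n)"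
proof -
  let ?H = "complete_split n"
  have bound: "n \<le> 2 * l"
    if cov: "cover complete_or_bipartite ?H Gs \<phi>" and wi: "weak_induced_cover ?H Gs \<phi>"
      and fib: "fibres_le ?H Gs \<phi> l" for Gs \<phi> l
  proof (cases "n = 0")
    case False
    let ?D = "disjoint_union Gs"
    have Gs: "set Gs \<subseteq> complete_or_bipartite" using cov by (simp add: cover_def)
    have hom: "graph_hom (guest_map \<phi> i) (Gs ! i) ?H" if "i < length Gs" for i
      using cov that by (simp add: cover_iff)
    have D: "fin_graph ?D"
      using Gs by (intro fin_graph_disjoint_union) (auto simp: complete_or_bipartite_def)
    define F where "F v = {w \<in> verts ?D. \<phi> w = v}" for v
    have finF: "finite (F v)" for v unfolding F_def using finite_verts[OF D] by simp
    have F: "card (F v) \<le> l" if "v < 2 * n" for v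
      using fib that unfolding fibres_le_def F_def complete_split_def by simp
    \<comment> \<open>The edge charged to a point is recovered from the point by \<open>right\<close> or \<open>left\<close>. Where the
      description is not unique, the value does not matter, as nothing is charged there.\<close>
    define right where "right w = (THE b. \<exists>z. {w, z} \<in> edges ?D \<and> n \<le> \<phi> z \<and> b = \<phi> z)" for w
    define left where "left z = (THE a. \<exists>w. {w, z} \<in> edges ?D \<and> \<phi> w < n \<and> a = \<phi> w)" for z
    have "{..<n} \<times> {n..<2 * n} \<subseteq> (\<lambda>w. (\<phi> w, right w)) ` (\<Union>a<n. F a) \<union> (\<lambda>z. (left z, \<phi> z)) ` (\<Union>b\<in>{n..<2*n}. F b)"
    proof
      fix ab assume ab: "ab \<in> {..<n} \<times> {n..<2 * n}"
      then obtain a b where ab: "ab = (a, b)" "a < n" "n \<le> b" "b < 2 * n" by auto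
      then have "{a, b} \<in> edges ?H" by (auto simp: complete_split_edge)
      then have "\<exists>e\<in>edges ?D. \<phi> ` e = {a, b}" using cov by (simp add: cover_def)
      then obtain e where e: "e \<in> edges ?D" "\<phi> ` e = {a, b}" by (elim bexE)
      obtain w z where wz: "{w, z} \<in> edges ?D" "\<phi> w = a" "\<phi> z = b"
        using edge_image_endpoints[OF D e] e(1) by metis
      have wzv: "w \<in> F a" "z \<in> F b" using edge_verts[OF D wz(1)] wz(2,3) unfolding F_def by auto
      have "(\<forall>z'. {w, z'} \<in> edges ?D \<longrightarrow> n \<le> \<phi> z' \<longrightarrow> \<phi> z' = b) \<or>
          (\<forall>w'. {w', z} \<in> edges ?D \<longrightarrow> \<phi> w' < n \<longrightarrow> \<phi> w' = a)"
      proof (rule ccontr)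
        assume "\<not> ?thesis"
        then obtain z' w' where c: "{w, z'} \<in> edges ?D" "n \<le> \<phi> z'" "\<phi> z' \<noteq> b"
          "{w', z} \<in> edges ?D" "\<phi> w' < n" "\<phi> w' \<noteq> a" by blast
        obtain i w0 z0 z1 w1 where
          i: "i < length Gs" "w = (i, w0)" "z = (i, z0)" "z' = (i, z1)" "w' = (i, w1)"
            "{w0, z0} \<in> edges (Gs ! i)" "{w0, z1} \<in> edges (Gs ! i)" "{w1, z0} \<in> edges (Gs ! i)"
          using wz(1) c(1,4) by (cases w; cases z; cases z'; cases w') (auto simp: edge_disjoint_union_iff)
        have "Gs ! i \<in> complete_or_bipartite" using Gs i(1) by auto
        moreover have "weak_induced_subgraph (graph_image (guest_map \<phi> i) (Gs ! i)) ?H"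
          using wi i(1) unfolding weak_induced_cover_def by blast
        ultimately show False
          using weak_induced_guest_in_complete_split[of "Gs ! i" "guest_map \<phi> i" n w0 z0 z1 w1]
            hom[OF i(1)] i c wz ab by (auto simp: guest_map_def)
      qed
      then show "ab \<in> (\<lambda>w. (\<phi> w, right w)) ` (\<Union>a<n. F a) \<union> (\<lambda>z. (left z, \<phi> z)) ` (\<Union>b\<in>{n..<2*n}. F b)"
      proof
        assume "\<forall>z'. {w, z'} \<in> edges ?D \<longrightarrow> n \<le> \<phi> z' \<longrightarrow> \<phi> z' = b"
        then have "right w = b" unfolding right_def using wz ab by (intro the_equality) blast+
        then show ?thesis using wzv wz ab by (intro UnI1 image_eqI[of _ _ w]) auto
      next
        assume "\<forall>w'. {w', z} \<in> edges ?D \<longrightarrow> \<phi> w' < n \<longrightarrow> \<phi> w' = a"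
        then have "left z = a" unfolding left_def using wz ab by (intro the_equality) blast+
        then show ?thesis using wzv wz ab by (intro UnI2 image_eqI[of _ _ z]) auto
      qed
    qed
    moreover have "finite ((\<lambda>w. (\<phi> w, right w)) ` (\<Union>a<n. F a) \<union> (\<lambda>z. (left z, \<phi> z)) ` (\<Union>b\<in>{n..<2*n}. F b))"
      by (intro finite_UnI finite_imageI finite_UN_I finF) auto
    ultimately have "card ({..<n} \<times> {n..<2 * n}) \<le>
        card ((\<lambda>w. (\<phi> w, right w)) ` (\<Union>a<n. F a) \<union> (\<lambda>z. (left z, \<phi> z)) ` (\<Union>b\<in>{n..<2*n}. F b))"
      by (rule card_mono[rotated])
    also have "\<dots> \<le> card (\<Union>a<n. F a) + card (\<Union>b\<in>{n..<2*n}. F b)"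
      by (intro order_trans[OF card_Un_le] add_mono card_image_le finite_UN_I finF) auto
    also have "\<dots> \<le> (\<Sum>a<n. card (F a)) + (\<Sum>b\<in>{n..<2*n}. card (F b))"
      by (intro add_mono card_UN_le) auto
    also have "\<dots> \<le> (\<Sum>a<n. l) + (\<Sum>b\<in>{n..<2*n}. l)"
      using F by (intro add_mono sum_mono) auto
    also have "\<dots> = n * (2 * l)" by simp
    also have "card ({..<n} \<times> {n..<2 * n}) = n * n" by simp
    finally have "n * n \<le> n * (2 * l)" .
    then show ?thesis using False by simp
  qed simp
  have half: "enat ((n + 1) div 2) \<le> ic_folded complete_or_bipartite ?H"
  proof (rule ic_folded_geI)
    fix Gs \<phi> l
    assume "cover complete_or_bipartite ?H Gs \<phi>" "weak_induced_cover ?H Gs \<phi>" "fibres_le ?H Gs \<phi> l"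
    then have "n \<le> 2 * l" by (rule bound)
    then show "enat ((n + 1) div 2) \<le> enat l" by simp
  qed
  show ?thesis
  proof (cases "ic_folded complete_or_bipartite ?H")
    case (enat m)
    with half have "n \<le> 2 * m" by simp
    then show ?thesis using enat by (simp add: numeral_eq_enat)
  qed (simp add: numeral_eq_enat)
qed

lemma not_bounded_for_hereditary_guests:
  "\<not> ic_c_bounded x complete_or_bipartite {H. fin_graph H}"
proof
  assume "ic_c_bounded x complete_or_bipartite {H. fin_graph H}"
  then obtain f where f: "\<And>(H :: nat graph) k. fin_graph H \<Longrightarrow> c_num x complete_or_bipartite H = enat k \<Longrightarrow>
      ic_num x complete_or_bipartite H \<le> enat (f k)"
    unfolding ic_c_bounded_def by auto
  \<comment> \<open>The covering number is at most 2, so only these values of \<open>f\<close> occur.\<close>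
  define m where "m = Max (f ` {..2})"
  define H where "H = complete_split (2 * m + 1)"
  note between = covering_numbers_between[OF graph_class_complete_or_bipartite, where H = H and x = x]
  have "c_num x complete_or_bipartite H \<le> enat 2"
    using between(2) c_union_complete_split unfolding H_def by (rule order_trans)
  then obtain k where k: "c_num x complete_or_bipartite H = enat k" "k \<le> 2"
    by (cases "c_num x complete_or_bipartite H") auto
  have "f k \<le> m" unfolding m_def using k(2) by (intro Max_ge) auto
  moreover have "ic_num x complete_or_bipartite H \<le> enat (f k)"
    using f k(1) fin_graph_complete_split unfolding H_def by blast
  ultimately have "ic_folded complete_or_bipartite H \<le> enat m"
    using between(3) by (meson enat_ord_simps(1) order_trans)
  then have "enat (2 * m + 1) \<le> 2 * enat m"
    using ic_folded_complete_split[of "2 * m + 1"] unfolding H_def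
    by (meson mult_left_mono order_trans zero_le)
  then show False by (simp add: numeral_eq_enat)
qed

section \<open>The Moser spindle and the square of the seven-cycle\<close>

text \<open>The Moser spindle: two pairs of triangles with a common edge (0, 1, 2, 3 and 0, 5, 6, 4) share
  the vertex 0, and their far ends 3 and 4 are adjacent. The labels make it a subgraph of the square
  of the cycle.\<close>

definition spindle :: "nat graph" where
  "spindle = Graph {..<7}
     {{0, 1}, {0, 2}, {1, 2}, {1, 3}, {2, 3}, {0, 6}, {0, 5}, {6, 5}, {6, 4}, {5, 4}, {3, 4}}"

definition cycle_square :: "nat graph" where
  "cycle_square = Graph {..<7} ((\<lambda>i. {i, (i + 1) mod 7}) ` {..<7} \<union> (\<lambda>i. {i, (i + 2) mod 7}) ` {..<7})"

definition spindles :: "nat graph set" where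
  "spindles = {G. fin_graph G \<and> isomorphic spindle G}"

lemma lessThan_7: "{..<7 :: nat} = {0, 1, 2, 3, 4, 5, 6}"
  by auto

lemma edges_cycle_square:
  "edges cycle_square = {{0, 1}, {1, 2}, {2, 3}, {3, 4}, {4, 5}, {5, 6}, {6, 0},
     {0, 2}, {1, 3}, {2, 4}, {3, 5}, {4, 6}, {5, 0}, {6, 1}}"
  unfolding cycle_square_def graph.sel lessThan_7 by (simp add: insert_commute numeral_2_eq_2)

lemma fin_graph_spindle: "fin_graph spindle"
  unfolding fin_graph_def spindle_def by simp

lemma fin_graph_cycle_square: "fin_graph cycle_square"
  unfolding fin_graph_def edges_cycle_square by (simp add: cycle_square_def)

text \<open>With three colours, the two ends of a pair of triangles with a common edge get the same
  colour. So 3 and 4 both get the colour of 0.\<close>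

lemma spindle_not_3_colourable:
  assumes "\<And>u v. {u, v} \<in> edges spindle \<Longrightarrow> c u \<noteq> (c v :: nat)"
  shows "\<exists>v<7. 3 \<le> c v"
proof (rule ccontr)
  assume "\<not> ?thesis"
  then have lt: "c v < 3" if "v < 7" for v using that by (meson leI)
  have ne: "c 0 \<noteq> c 1" "c 0 \<noteq> c 2" "c 1 \<noteq> c 2" "c 1 \<noteq> c 3" "c 2 \<noteq> c 3"
    "c 0 \<noteq> c 6" "c 0 \<noteq> c 5" "c 6 \<noteq> c 5" "c 6 \<noteq> c 4" "c 5 \<noteq> c 4" "c 3 \<noteq> c 4"
    by (rule assms; simp add: spindle_def)+
  have "c 3 = c 0" using ne(1-5) lt[of 0] lt[of 1] lt[of 2] lt[of 3] by linarith
  moreover have "c 4 = c 0" using ne(6-10) lt[of 0] lt[of 4] lt[of 5] lt[of 6] by linarith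
  ultimately show False using ne(11) by simp
qed

text \<open>Without \<open>w\<close> the cycle becomes a path on which the other vertices sit at the positions 0 to 5,
  and the colours 0, 1, 2 repeat along it. The summand 6 keeps the subtraction from truncating.
  Adjacent vertices have positions that differ by 1, 2 or 5, and none of these is a multiple of 3.\<close>

lemma cycle_square_minus_vertex_3_colourable:
  assumes "{u, v} \<in> edges cycle_square" "u \<noteq> w" "v \<noteq> w" "w < 7"
  shows "(u + 6 - w) mod 7 mod 3 \<noteq> (v + 6 - w) mod 7 mod 3"
proof -
  have "w \<in> {0, 1, 2, 3, 4, 5, 6}" using assms(4) by auto
  then show ?thesis
    using assms(1-3) unfolding edges_cycle_square by (auto simp: doubleton_eq_iff)
qed

text \<open>If the homomorphism missed \<open>w\<close>, the colouring of the square of the cycle without \<open>w\<close> could be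
  pulled back to the spindle.\<close>

lemma spindle_hom_surj:
  assumes "graph_hom f spindle cycle_square"
  shows "f ` verts spindle = verts cycle_square"
proof (rule ccontr)
  assume ne: "f ` verts spindle \<noteq> verts cycle_square"
  have V: "verts spindle = {..<7}" "verts cycle_square = {..<7}"
    unfolding spindle_def cycle_square_def by simp_all
  have "f ` verts spindle \<subseteq> verts cycle_square" using assms unfolding graph_hom_def by simp
  then obtain w where w: "w < 7" "w \<notin> f ` {..<7}" using ne V by auto
  have "(f u + 6 - w) mod 7 mod 3 \<noteq> (f v + 6 - w) mod 7 mod 3" if uv: "{u, v} \<in> edges spindle" for u v
  proof (rule cycle_square_minus_vertex_3_colourable[OF _ _ _ w(1)])
    have "f ` {u, v} \<in> edges cycle_square" using assms uv unfolding graph_hom_def by blast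
    then show "{f u, f v} \<in> edges cycle_square" by simp
    have "u < 7" "v < 7" using edge_verts[OF fin_graph_spindle uv] V by auto
    then show "f u \<noteq> w" "f v \<noteq> w" using w(2) by auto
  qed
  then obtain v where "3 \<le> (f v + 6 - w) mod 7 mod 3"
    using spindle_not_3_colourable[of "\<lambda>v. (f v + 6 - w) mod 7 mod 3"] by blast
  moreover have "(f v + 6 - w) mod 7 mod 3 < 3" by simp
  ultimately show False by linarith
qed

lemma connected_spindle: "connected_graph spindle"
proof -
  have "{0, 1} \<in> edges spindle" "{0, 2} \<in> edges spindle" "{1, 3} \<in> edges spindle"
    "{0, 6} \<in> edges spindle" "{0, 5} \<in> edges spindle" "{6, 4} \<in> edges spindle"
    by (simp_all add: spindle_def)
  then have a: "(0, 1) \<in> adj spindle" "(0, 2) \<in> adj spindle" "(1, 3) \<in> adj spindle"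
    "(0, 6) \<in> adj spindle" "(0, 5) \<in> adj spindle" "(6, 4) \<in> adj spindle"
    unfolding adj_def by auto
  have "(0, v) \<in> (adj spindle)\<^sup>*" if "v \<in> verts spindle" for v
  proof -
    have "v \<in> {0, 1, 2, 3, 4, 5, 6}" using that unfolding spindle_def by auto
    moreover have "(0, 3) \<in> (adj spindle)\<^sup>*" "(0, 4) \<in> (adj spindle)\<^sup>*"
      using a by (meson r_into_rtrancl rtrancl_into_rtrancl)+
    ultimately show ?thesis using a by (auto intro: r_into_rtrancl)
  qed
  moreover have "(v, 0) \<in> (adj spindle)\<^sup>*" if "v \<in> verts spindle" for v
    using calculation[OF that] sym_rtrancl[OF sym_adj] by (metis symE)
  ultimately have "(u, v) \<in> (adj spindle)\<^sup>*" if "u \<in> verts spindle" "v \<in> verts spindle" for u v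
    using that rtrancl_trans by metis
  moreover have "verts spindle \<noteq> {}" unfolding spindle_def lessThan_7 by simp
  ultimately show ?thesis unfolding connected_graph_def by blast
qed

lemma rtrancl_adj_image:
  assumes "(u, v) \<in> (adj G)\<^sup>*"
  shows "(f u, f v) \<in> (adj (graph_image f G))\<^sup>*"
  using assms
proof (induction rule: rtrancl_induct)
  case (step y z)
  have "f ` {y, z} \<in> edges (graph_image f G)"
    using step(2) imageI[of "{y, z}" "edges G" "(`) f"] unfolding adj_def graph_image_def by simp
  then have "(f y, f z) \<in> adj (graph_image f G)" unfolding adj_def by simp
  then show ?case using step(3) by (simp add: rtrancl_into_rtrancl)
qed simp

lemma graph_class_iso_closure:
  "graph_class {G. fin_graph G \<and> isomorphic F G}"
  unfolding graph_class_def isomorphic_def using graph_iso_comp by blast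

text \<open>A connected graph is its own only component.\<close>

lemma component_closed_spindles: "component_closed spindles"
  unfolding component_closed_def
proof (intro ballI allI impI)
  fix G K assume G: "G \<in> spindles" and K: "component K G"
  obtain f where f: "graph_iso f spindle G" and fG: "fin_graph G"
    using G unfolding spindles_def isomorphic_def by blast
  have Gim: "edges (graph_image f spindle) \<subseteq> edges G"
    using graph_iso_edge[OF fin_graph_spindle f] unfolding graph_image_def by auto
  have fV: "verts G = f ` verts spindle" using f unfolding graph_iso_def bij_betw_def by simp
  have "(u, v) \<in> (adj G)\<^sup>*" if uv: "u \<in> verts G" "v \<in> verts G" for u v
  proof -
    obtain x y where "u = f x" "v = f y" "x \<in> verts spindle" "y \<in> verts spindle"
      using uv fV by auto
    moreover from this have "(x, y) \<in> (adj spindle)\<^sup>*"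
      using connected_spindle unfolding connected_graph_def by blast
    ultimately have "(u, v) \<in> (adj (graph_image f spindle))\<^sup>*"
      using rtrancl_adj_image[of x y spindle f] by simp
    then show ?thesis using adj_mono[OF Gim] by blast
  qed
  moreover have "verts G \<noteq> {}" unfolding fV spindle_def lessThan_7 by simp
  ultimately have "connected_graph G" unfolding connected_graph_def by blast
  then have "G = K" using K fG unfolding component_def subgraph_def by blast
  then show "K \<in> spindles" using G by simp
qed

text \<open>The image of a spindle is connected and contains all vertices. If it were weak induced, it would
  have to contain all 14 edges.\<close>

lemma no_weak_induced_spindle_cover:
  "ic_folded spindles cycle_square = \<infinity>"
proof -
  have False if cov: "cover spindles cycle_square Gs \<phi>" and wi: "weak_induced_cover cycle_square Gs \<phi>"
    for Gs \<phi>
  proof -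
    have "{0, 1} \<in> edges cycle_square" unfolding edges_cycle_square by simp
    then obtain i where i: "i < length Gs" using cov by (force simp: cover_iff)
    have G: "Gs ! i \<in> spindles" using cov nth_mem[OF i] by (auto simp: cover_def)
    then obtain g where g: "graph_iso g spindle (Gs ! i)" and fG: "fin_graph (Gs ! i)"
      unfolding spindles_def isomorphic_def by blast
    define f where "f = guest_map \<phi> i \<circ> g"
    let ?K = "graph_image (guest_map \<phi> i) (Gs ! i)"
    have gV: "verts (Gs ! i) = g ` verts spindle" using g unfolding graph_iso_def bij_betw_def by simp
    have gE: "edges (Gs ! i) = (`) g ` edges spindle"
    proof (intro equalityI subsetI)
      fix e assume "e \<in> edges (Gs ! i)"
      then obtain e' where "e' \<in> edges spindle" "g ` e' = e"
        by (rule graph_iso_edge_surj[OF fG g])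
      then show "e \<in> (`) g ` edges spindle" by auto
    qed (use graph_iso_edge[OF fin_graph_spindle g] in auto)
    have K: "?K = graph_image f spindle"
      unfolding graph_image_def gV gE f_def by (simp add: image_image)
    have "graph_hom (guest_map \<phi> i) (Gs ! i) cycle_square" using cov i by (simp add: cover_iff)
    then have "graph_hom f spindle cycle_square"
      unfolding graph_hom_def gV gE f_def by (simp add: image_image)
    then have surj: "f ` verts spindle = verts cycle_square" by (rule spindle_hom_surj)
    have reach: "(u, v) \<in> (adj ?K)\<^sup>*" if uv: "u \<in> verts cycle_square" "v \<in> verts cycle_square" for u v
    proof -
      obtain x y where "u = f x" "v = f y" "x \<in> verts spindle" "y \<in> verts spindle"
        using uv surj[symmetric] by auto
      moreover from this have "(x, y) \<in> (adj spindle)\<^sup>*"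
        using connected_spindle unfolding connected_graph_def by blast
      ultimately show ?thesis unfolding K using rtrancl_adj_image[of x y spindle f] by simp
    qed
    have "edges cycle_square \<subseteq> edges ?K"
    proof
      fix e assume e: "e \<in> edges cycle_square"
      then obtain u v where uv: "e = {u, v}" "u \<noteq> v" "u \<in> verts cycle_square" "v \<in> verts cycle_square"
        by (rule edge_doubleton[OF fin_graph_cycle_square])
      have "verts ?K = verts cycle_square" using surj unfolding K by (simp add: graph_image_def)
      then show "e \<in> edges ?K"
        using wi i uv e reach unfolding weak_induced_cover_def weak_induced_iff by blast
    qed
    also have "edges ?K = (`) f ` edges spindle" unfolding K by (simp add: graph_image_def)
    finally have "card (edges cycle_square) \<le> card (edges spindle)"
      using finite_edges[OF fin_graph_spindle] by (meson card_image_le card_mono finite_imageI order_trans)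
    moreover have "card (edges cycle_square) = 14"
      unfolding edges_cycle_square by (simp add: doubleton_eq_iff card_insert_if)
    moreover have "card (edges spindle) = 11"
      unfolding spindle_def by (simp add: doubleton_eq_iff card_insert_if)
    ultimately show False by simp
  qed
  then have "\<infinity> \<le> ic_folded spindles cycle_square" by (intro ic_folded_geI) blast
  then show ?thesis by simp
qed

lemma c_union_cycle_square: "c_union spindles cycle_square \<le> enat 2"
proof -
  \<comment> \<open>The standard spindle misses the edges 24, 35 and 16, which its rotation by 2 contains.\<close>
  define r where "r t i = (i + t) mod 7" for t i :: nat
  define K where "K t = graph_image (r t) spindle" for t
  have inj: "inj_on (r t) (verts spindle)" if "t \<in> {0, 2}" for t
    using that unfolding r_def spindle_def lessThan_7 by (auto simp: inj_on_def)
  have sub: "subgraph (K t) cycle_square" if "t \<in> {0, 2}" for t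
  proof -
    have "graph_hom (r t) spindle cycle_square"
      unfolding graph_hom_def
    proof (intro conjI)
      show "r t ` verts spindle \<subseteq> verts cycle_square"
        by (auto simp: spindle_def cycle_square_def r_def)
      have "t = 0 \<or> t = 2" using that by simp
      then show "\<forall>e\<in>edges spindle. r t ` e \<in> edges cycle_square"
        unfolding edges_cycle_square
        by (elim disjE) (simp_all add: spindle_def r_def doubleton_eq_iff)
    qed
    then show ?thesis
      unfolding K_def by (rule fin_graph_image_hom[OF fin_graph_spindle fin_graph_cycle_square])
  qed
  have "K t \<in> spindles" if t: "t \<in> {0, 2}" for t
  proof -
    have "graph_iso (r t) spindle (K t)"
      unfolding K_def using graph_iso_image_iff[OF fin_graph_spindle] inj[OF t] by blast
    then show ?thesis using sub[OF t] unfolding spindles_def isomorphic_def subgraph_def by blast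
  qed
  then have "K t \<in> disjoint_unions spindles" if "t \<in> {0, 2}" for t
    using that sub unfolding subgraph_def by (blast intro: in_disjoint_unions)
  moreover have "edges cycle_square \<subseteq> (\<Union>t\<in>{0, 2}. edges (K t))"
    unfolding edges_cycle_square K_def graph_image_def spindle_def r_def
    by (simp add: insert_commute doubleton_eq_iff)
  ultimately have "c_union spindles cycle_square \<le> enat (card {0 :: nat, 2})"
    using sub by (intro subgraph_family_cover(1)[where K = K]) auto
  then show ?thesis by (simp add: numeral_2_eq_2)
qed

text \<open>A single bag with all vertices is a tree decomposition.\<close>

lemma treewidth_le_card:
  assumes "fin_graph G" "verts G \<noteq> {}"
  shows "treewidth G \<le> card (verts G) - 1"
proof -
  define T where "T = Graph {0 :: nat} {}"
  have T: "is_tree T"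
    unfolding is_tree_def fin_graph_def connected_graph_def is_cycle_def T_def by simp
  have "tree_decomposition G T (\<lambda>_. verts G)"
    unfolding tree_decomposition_def
  proof (intro conjI ballI T)
    fix v assume "v \<in> verts G"
    show "\<exists>S. induced_subgraph S T \<and> verts S = {t \<in> verts T. v \<in> verts G} \<and> connected_graph S"
      using T \<open>v \<in> verts G\<close> unfolding is_tree_def
      by (intro exI[of _ T]) (auto simp: induced_subgraph_def subgraph_def T_def)
  qed (use assms(1) in \<open>auto simp: T_def fin_graph_def\<close>)
  moreover have "decomposition_width T (\<lambda>_. verts G) = card (verts G) - 1"
    unfolding decomposition_width_def T_def by simp
  ultimately show ?thesis unfolding treewidth_def by (intro Least_le) blast
qed

section \<open>Boundedness of induced covering numbers\<close>

theorem theorem3: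
  fixes x :: variant
  shows "(\<forall>\<G> \<H>. graph_class \<G> \<and> graph_class \<H> \<and>
            ((hereditary \<G> \<and> bdd_above (mad ` \<G>)) \<or>
             (hereditary \<G> \<and> bdd_above (mad ` \<H>)))
            \<longrightarrow> ic_c_bounded x \<G> \<H>)
       \<and> (\<exists>\<G> \<H>. graph_class \<G> \<and> graph_class \<H> \<and> hereditary \<G> \<and>
            \<not> ic_c_bounded x \<G> \<H>)
       \<and> (\<exists>\<G> \<H>. graph_class \<G> \<and> graph_class \<H> \<and> component_closed \<G> \<and>
            bdd_above (treewidth ` \<H>) \<and> \<not> ic_c_bounded x \<G> \<H>)"
proof (intro conjI)
  show "\<forall>\<G> \<H>. graph_class \<G> \<and> graph_class \<H> \<and>
            ((hereditary \<G> \<and> bdd_above (mad ` \<G>)) \<or>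
             (hereditary \<G> \<and> bdd_above (mad ` \<H>)))
            \<longrightarrow> ic_c_bounded x \<G> \<H>"
    by (intro allI impI ic_c_bounded_if_mad_bounded) (elim conjE disjE; simp)+
next
  have "graph_class {H :: nat graph. fin_graph H}" unfolding graph_class_def by simp
  then show "\<exists>\<G> \<H>. graph_class \<G> \<and> graph_class \<H> \<and> hereditary \<G> \<and> \<not> ic_c_bounded x \<G> \<H>"
    using graph_class_complete_or_bipartite hereditary_complete_or_bipartite
      not_bounded_for_hereditary_guests[of x]
    by (intro exI[of _ complete_or_bipartite] exI[of _ "{H :: nat graph. fin_graph H}"]) simp
next
  let ?\<H> = "{H :: nat graph. fin_graph H \<and> isomorphic cycle_square H}"
  have "treewidth H \<le> 6" if H: "H \<in> ?\<H>" for H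
  proof -
    obtain f where "bij_betw f (verts cycle_square) (verts H)"
      using H unfolding isomorphic_def graph_iso_def by blast
    then have "card (verts H) = 7"
      using bij_betw_same_card[of f "verts cycle_square"] by (simp add: cycle_square_def)
    then show ?thesis using treewidth_le_card[of H] H by fastforce
  qed
  then have "bdd_above (treewidth ` ?\<H>)" by (intro bdd_aboveI[of _ 6]) blast
  moreover have "graph_class spindles" unfolding spindles_def by (rule graph_class_iso_closure)
  moreover have "\<not> ic_c_bounded x spindles ?\<H>"
  proof
    assume b: "ic_c_bounded x spindles ?\<H>"
    note between = covering_numbers_between[OF \<open>graph_class spindles\<close>, where H = cycle_square and x = x]
    have "c_num x spindles cycle_square \<le> enat 2"
      using between(2) c_union_cycle_square by (rule order_trans)
    then obtain k where k: "c_num x spindles cycle_square = enat k"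
      by (cases "c_num x spindles cycle_square") auto
    have "graph_iso id cycle_square cycle_square" unfolding graph_iso_def by simp
    then have "cycle_square \<in> ?\<H>" using fin_graph_cycle_square unfolding isomorphic_def by blast
    then obtain l where "ic_num x spindles cycle_square \<le> enat l"
      using b k unfolding ic_c_bounded_def by blast
    then show False using between(3) no_weak_induced_spindle_cover by simp
  qed
  ultimately show "\<exists>\<G> \<H>. graph_class \<G> \<and> graph_class \<H> \<and> component_closed \<G> \<and>
      bdd_above (treewidth ` \<H>) \<and> \<not> ic_c_bounded x \<G> \<H>"
    using component_closed_spindles graph_class_iso_closure[of cycle_square]
    by (intro exI[of _ spindles] exI[of _ ?\<H>] conjI)
qed

end
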